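(* Let $b$ and $c$ be real numbers with $0<b\le c$. (1) If $c\ge 2$, then $$\kappa\bigl(z\,{}_2F_1(1,b;c;z)\bigr)=\frac{4-b-c}{2}+\frac{c-2}{2}\cdot\frac{{}_2F_1(1,b;c;-1)}{{}_2F_1(2,b;c;-1)}.$$ (2) If $1\le c<\min\{2,1+b\}$, then $$\kappa\bigl(z\,{}_2F_1(1,b;c;z)\bigr)=\frac{(c-b)(c+b-3)}{2(1+b-c)}.$$
   Context: $\mathbb D=\{z\in\mathbb C:|z|<1\}$. For real $a,b,c$ with $c\ne 0,-1,-2,\dots$, ${}_2F_1(a,b;c;z)=\sum_{n=0}^\infty \frac{(a)_n(b)_n}{(c)_n n!}z^n$ for $z\in\mathbb D$, where $(a)_0=1$ and $(a)_n=a(a+1)\cdots(a+n-1)$; values at $z=-1$ are those of its analytic continuation to $\mathbb C\setminus[1,+\infty)$. For $f$ analytic in $\mathbb D$ with $f(0)=0$, $f'(0)=1$, the order of convexity of $f$ is $\kappa(f)=1+\inf_{z\in\mathbb D}\operatorname{Re}\frac{zf''(z)}{f'(z)}\in[-\infty,1]$; it is regarded as not defined if $f'$ has zeros in $\mathbb D$. *)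

theory Defs
  imports "HOL-Complex_Analysis.Complex_Analysis"
begin

definition hyp2F1_series :: "real \<Rightarrow> real \<Rightarrow> real \<Rightarrow> complex \<Rightarrow> complex" where
  "hyp2F1_series a b c z =
     eval_fps (fps_hypergeo [complex_of_real a, complex_of_real b] [complex_of_real c] 1) z"

lemma hyp2F1_series_eq:
  "hyp2F1_series a b c z =
     (\<Sum>n. complex_of_real (pochhammer a n * pochhammer b n / (pochhammer c n * fact n)) * z ^ n)"
  by (simp add: hyp2F1_series_def eval_fps_def pochhammer_of_real)

text \<open>The complex plane cut along the real half-line from 1 to infinity, 1 included in the cut.\<close>

definition cut_plane :: "complex set" where
  "cut_plane = - (complex_of_real ` {1..})"

text \<open>
  Outside the unit disc the value at \<open>z\<close> is the value of the holomorphic extension of the series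
  to the cut plane. The description operator is applied to the value and not to the extension \<open>g\<close>,
  because a total function \<open>g\<close> is not determined on the cut. Values on the cut itself
  carry no meaning.
\<close>

definition hyp2F1 :: "real \<Rightarrow> real \<Rightarrow> real \<Rightarrow> complex \<Rightarrow> complex" where
  "hyp2F1 a b c z =
     (if z \<in> ball 0 1 then hyp2F1_series a b c z
      else (THE w. \<exists>g. g holomorphic_on cut_plane
                     \<and> (\<forall>u\<in>ball 0 1. g u = hyp2F1_series a b c u)
                     \<and> w = g z))"

text \<open>
  The result is \<open>None\<close> when the order of convexity is not defined: \<open>f\<close> is not a normalized analytic
  function on the disc, or its derivative vanishes somewhere in the disc. The infimum is taken in
  the extended reals, so it may be \<open>-\<infinity>\<close>.
\<close>

definition order_of_convexity :: "(complex \<Rightarrow> complex) \<Rightarrow> ereal option" where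
  "order_of_convexity f =
     (if f analytic_on ball 0 1 \<and> f 0 = 0 \<and> deriv f 0 = 1 \<and> (\<forall>z\<in>ball 0 1. deriv f z \<noteq> 0)
      then Some (1 + (INF z\<in>ball 0 1. ereal (Re (z * deriv (deriv f) z / deriv f z))))
      else None)"

end

theory Submission
  imports Defs
begin

text \<open>
  Write \<open>F\<^sub>a = F(a,b;c;z)\<close>. Since \<open>(2)\<^sub>n = (n + 1)!\<close>, the derivative of \<open>z F\<^sub>1\<close> is \<open>F\<^sub>2\<close>, so the
  order of convexity is \<open>1 + inf Re (z F\<^sub>2' / F\<^sub>2)\<close>, and the question is where this real part is
  smallest.

  For \<open>c \<ge> 2\<close> it is smallest, in the limit, at \<open>-1\<close>. Indeed \<open>z F\<^sub>2' = 2 (F\<^sub>3 - F\<^sub>2)\<close>, and for \<open>0 \<le> a \<le> c\<close>, \<open>0 < b \<le> c\<close>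
  the quotient \<open>F\<^bsub>a+1\<^esub> / F\<^sub>a\<close> has a continued fraction, found by Gauss, whose coefficients are
  \<open>(1 - g\<^sub>k\<^sub>-\<^sub>1) g\<^sub>k\<close> with \<open>0 \<le> g\<^sub>k \<le> 1\<close>. Such a fraction is \<open>\<integral> d\<mu>(t) / (1 - t z)\<close> for a probability measure
  \<open>\<mu>\<close> on \<open>[0,1]\<close>, and each \<open>Re (1 / (1 - t z))\<close> with \<open>|z| \<le> r\<close> is least at \<open>z = -r\<close>. The measure is not
  constructed. The continued fraction yields a symmetric contraction \<open>S\<close> (a Jacobi operator) with
  \<open>m\<^sub>n = \<langle>e\<^sub>0, S\<^bsup>2n\<^esup> e\<^sub>0\<rangle>\<close> as Taylor coefficients (\<open>continued_fraction_hausdorff\<close>), hence the linear functional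
  \<open>t\<^sup>n \<mapsto> m\<^sub>n\<close> is nonnegative on \<open>t\<^sup>s |k(t)|\<^sup>2\<close> and \<open>t\<^sup>s (1 - t) |k(t)|\<^sup>2\<close>. The inequality
  \<open>Re f(z) \<ge> f(-r)\<close> follows because the difference of the two kernels is a combination of such
  expressions (\<open>hausdorff_Re_ge_negative_axis\<close>). The limit \<open>r \<rightarrow> 1\<close> is expressed by the continuations of
  \<open>F\<^sub>1\<close> and \<open>F\<^sub>2\<close>, through the first-order relation \<open>z (1 - z) F\<^sub>2' = (2 - c + b z) F\<^sub>2 + (c - 2) F\<^sub>1\<close>; the
  continuation of \<open>F\<^sub>1\<close> to the cut plane comes from an Euler integral. Moreover \<open>Re f \<ge> 1/2\<close> for every such
  quotient \<open>f\<close>, so \<open>F\<^sub>2 = (F\<^sub>2 / F\<^sub>1) (F\<^sub>1 / F\<^sub>0)\<close> has no zeros in the disc as soon as \<open>c \<ge> 1\<close>.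

  For \<open>1 \<le> c < min {2, 1 + b}\<close> the infimum is approached at \<open>1\<close>. Euler's transformation gives
  \<open>F\<^sub>2 = (1 - z)\<^bsup>c-b-2\<^esup> H\<close> with \<open>H = F(c-2, c-b; c; z)\<close>, so that
  \<open>z F\<^sub>2' / F\<^sub>2 = (2 + b - c) z / (1 - z) + z H' / H\<close>. All coefficients of \<open>1 - H\<close> are nonnegative, and the
  series of \<open>z H'\<close> converges absolutely on the closed disc. Hence \<open>|z H' / H|\<close> is at most its value at
  \<open>1\<close>, where \<open>H' / H\<close> is real and not positive, while \<open>Re (z / (1 - z)) > -1/2\<close>. Both bounds are
  sharp simultaneously along a path tending to \<open>1\<close> tangentially to the circle. The value of \<open>H' / H\<close> at
  \<open>1\<close> follows by summing the coefficient recursion (\<open>sum_relation\<close>).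
\<close>

unbundle no vec_syntax

section \<open>Contiguous relations and the Euler transformation for formal hypergeometric series\<close>

definition gauss_fps :: "real \<Rightarrow> real \<Rightarrow> real \<Rightarrow> real fps" where
  "gauss_fps a b c = Abs_fps (\<lambda>n. pochhammer a n * pochhammer b n / (pochhammer c n * fact n))"

lemma gauss_fps_commute: "gauss_fps a b c = gauss_fps b a c"
  by (simp add: gauss_fps_def mult.commute)

lemma gauss_fps_nth_0 [simp]: "gauss_fps a b c $ 0 = 1"
  by (simp add: gauss_fps_def)

lemma gauss_fps_0 [simp]: "gauss_fps 0 b c = 1"
  by (auto simp: gauss_fps_def fps_eq_iff pochhammer_0_left)

lemma gauss_fps_rec:
  assumes "c > 0"
  shows "(c + real n) * real (Suc n) * gauss_fps a b c $ Suc n = (a + real n) * (b + real n) * gauss_fps a b c $ n"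
proof -
  have "pochhammer c n > 0" "c + real n > 0" using assms by (auto intro: pochhammer_pos)
  then show ?thesis
    by (simp add: gauss_fps_def pochhammer_Suc divide_simps del: of_nat_Suc)
qed

text \<open>
  This identity starts the continued fraction of \<open>F(a+1,b;c) / F(a,b;c)\<close>; the two Gauss relations below
  produce all further partial quotients.
\<close>
lemma gauss_fps_raise_first:
  assumes "c > 0"
  shows "gauss_fps (a + 1) b c - gauss_fps a b c = fps_const (b / c) * fps_X * gauss_fps (a + 1) (b + 1) (c + 1)"
proof (rule fps_ext)
  fix n
  show "(gauss_fps (a + 1) b c - gauss_fps a b c) $ n
      = (fps_const (b / c) * fps_X * gauss_fps (a + 1) (b + 1) (c + 1)) $ n"
  proof (cases n)
    case (Suc m)
    have "pochhammer (c + 1) m > 0" using assms by (auto intro: pochhammer_pos)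
    moreover have "pochhammer (a + 1) (Suc m) = pochhammer (a + 1) m * (a + 1 + real m)"
      "pochhammer a (Suc m) = a * pochhammer (a + 1) m" by (rule pochhammer_Suc, rule pochhammer_rec)
    ultimately show ?thesis using Suc assms
      by (simp add: gauss_fps_def mult.assoc pochhammer_rec[of b] pochhammer_rec[of c] divide_simps)
         (simp add: algebra_simps)
  qed (simp add: mult.assoc)
qed

text \<open>
  Dividing by \<open>F(a,b+1;c+1)\<close> turns this relation, and its mirror image under exchange of \<open>a\<close> and \<open>b\<close>,
  into the alternating steps of the continued fraction of Gauss.
\<close>
lemma gauss_fps_gauss_second:
  assumes "c > 0"
  shows "gauss_fps a b c = gauss_fps a (b + 1) (c + 1)
           - fps_const (a * (c - b) / (c * (c + 1))) * fps_X * gauss_fps (a + 1) (b + 1) (c + 2)"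
proof (rule fps_ext)
  fix n
  show "gauss_fps a b c $ n = (gauss_fps a (b + 1) (c + 1)
           - fps_const (a * (c - b) / (c * (c + 1))) * fps_X * gauss_fps (a + 1) (b + 1) (c + 2)) $ n"
  proof (cases n)
    case (Suc m)
    have p: "pochhammer (c + 2) m > 0" using assms by (auto intro: pochhammer_pos)
    have b: "pochhammer (b + 1) (Suc m) = pochhammer (b + 1) m * (b + 1 + real m)"
      by (simp add: pochhammer_Suc)
    have c1: "pochhammer (c + 1) (Suc m) = (c + 1) * pochhammer (c + 2) m"
      by (simp add: pochhammer_rec add.commute add.left_commute)
    then have c2: "pochhammer (c + 1) m = (c + 1) * pochhammer (c + 2) m / (c + 1 + real m)"
      using assms by (simp add: pochhammer_Suc field_simps)
    show ?thesis using Suc assms p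
      apply (simp add: gauss_fps_def mult.assoc b c1 pochhammer_rec[of b] pochhammer_rec[of a]
          pochhammer_rec[of c] c2 )
      by (simp add: divide_simps) (simp add: algebra_simps)
  qed (simp add: mult.assoc)
qed

lemma gauss_fps_gauss_first:
  assumes "c > 0"
  shows "gauss_fps a b c = gauss_fps (a + 1) b (c + 1)
           - fps_const (b * (c - a) / (c * (c + 1))) * fps_X * gauss_fps (a + 1) (b + 1) (c + 2)"
  using gauss_fps_gauss_second[OF assms, of b a] by (simp add: gauss_fps_commute)

lemma gauss_fps_euler_operator:
  "fps_X * fps_deriv (gauss_fps a b c) = fps_const a * (gauss_fps (a + 1) b c - gauss_fps a b c)"
proof (rule fps_ext)
  fix n
  have "a * pochhammer (a + 1) n = pochhammer a n * (a + real n)"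
    using pochhammer_rec[of a n] pochhammer_Suc[of a n] by simp
  then have "a * (pochhammer (a + 1) n * q) = pochhammer a n * (a + real n) * q" for q
    by (metis mult.assoc)
  then show "(fps_X * fps_deriv (gauss_fps a b c)) $ n = (fps_const a * (gauss_fps (a + 1) b c - gauss_fps a b c)) $ n"
    by (cases n) (simp_all add: gauss_fps_def right_diff_distrib times_divide_eq_right[symmetric] 
      ring_distribs mult.assoc del: times_divide_eq_right of_nat_Suc pochhammer_Suc)
qed

definition hypergeometric_ode :: "real \<Rightarrow> real \<Rightarrow> real \<Rightarrow> real fps \<Rightarrow> bool" where
  "hypergeometric_ode a b c Y \<longleftrightarrow>
     fps_X * (1 - fps_X) * fps_deriv (fps_deriv Y)
     + (fps_const c - fps_const (a + b + 1) * fps_X) * fps_deriv Y - fps_const (a * b) * Y = 0"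

text \<open>
  The two-term recursion has only one solution with given constant term as long as \<open>c > 0\<close>, which makes
  the differential equation a tool for proving identities between formal series.
\<close>
lemma hypergeometric_ode_iff:
  "hypergeometric_ode a b c Y \<longleftrightarrow>
     (\<forall>n. (c + real n) * real (Suc n) * Y $ Suc n = (a + real n) * (b + real n) * Y $ n)"
proof -
  have "(fps_X * (1 - fps_X) * fps_deriv (fps_deriv Y)
     + (fps_const c - fps_const (a + b + 1) * fps_X) * fps_deriv Y - fps_const (a * b) * Y) $ n
     = (c + real n) * real (Suc n) * Y $ Suc n - (a + real n) * (b + real n) * Y $ n" for n
  proof -
    have *: "fps_X * (1 - fps_X) * fps_deriv (fps_deriv Y)
     + (fps_const c - fps_const (a + b + 1) * fps_X) * fps_deriv Y - fps_const (a * b) * Y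
     = fps_X * fps_deriv (fps_deriv Y) - fps_X * (fps_X * fps_deriv (fps_deriv Y)) 
     + fps_const c * fps_deriv Y - fps_const (a + b + 1) * (fps_X * fps_deriv Y) - fps_const (a * b) * Y"
      by (simp add: algebra_simps)
    show ?thesis unfolding *
      by (cases n; cases "n - 1") (auto simp: algebra_simps)
  qed
  then show ?thesis unfolding hypergeometric_ode_def fps_eq_iff by simp
qed

lemma hypergeometric_ode_gauss_fps: "c > 0 \<Longrightarrow> hypergeometric_ode a b c (gauss_fps a b c)"
  by (simp add: hypergeometric_ode_iff gauss_fps_rec del: of_nat_Suc)

lemma hypergeometric_ode_unique:
  assumes "c > 0" "hypergeometric_ode a b c Y" "Y $ 0 = 1"
  shows "Y = gauss_fps a b c"
proof (rule fps_ext)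
  fix n show "Y $ n = gauss_fps a b c $ n"
  proof (induction n)
    case (Suc n)
    have "(c + real n) * real (Suc n) * Y $ Suc n = (c + real n) * real (Suc n) * gauss_fps a b c $ Suc n"
      using assms(2) Suc gauss_fps_rec[OF assms(1), of n a b] by (simp add: hypergeometric_ode_iff del: of_nat_Suc)
    moreover have "(c + real n) * real (Suc n) \<noteq> 0" using assms(1) by (simp del: of_nat_Suc)
    ultimately show ?case by (metis mult_left_cancel)
  qed (simp add: assms)
qed

text \<open>
  The Taylor series of \<open>(1 - z)\<^sup>s\<close>.
\<close>
definition one_minus_power :: "real \<Rightarrow> real fps" where
  "one_minus_power s = Abs_fps (\<lambda>n. pochhammer (-s) n / fact n)"

lemma one_minus_power_nth_0 [simp]: "one_minus_power s $ 0 = 1"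
  by (simp add: one_minus_power_def)

lemma one_minus_power_ode: "(1 - fps_X) * fps_deriv (one_minus_power s) = fps_const (-s) * one_minus_power s"
proof (rule fps_ext)
  fix n
  have e: "(1 - fps_X) * fps_deriv (one_minus_power s) = fps_deriv (one_minus_power s) - fps_X * fps_deriv (one_minus_power s)"
    by (simp add: algebra_simps)
  show "((1 - fps_X) * fps_deriv (one_minus_power s)) $ n = (fps_const (-s) * one_minus_power s) $ n"
    unfolding e 
    by (cases n) (auto simp: one_minus_power_def pochhammer_Suc divide_simps, auto simp: algebra_simps)
qed

lemma fps_deriv_eq_0D: "fps_deriv Y = 0 \<Longrightarrow> Y = fps_const (Y $ 0)" for Y :: "real fps"
  by (simp add: fps_deriv_eq_0_iff)

lemma one_minus_power_inverse: "one_minus_power s * one_minus_power (-s) = 1"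
proof -
  have "(1 - fps_X) * fps_deriv (one_minus_power s * one_minus_power (-s))
      = ((1 - fps_X) * fps_deriv (one_minus_power s)) * one_minus_power (-s) + one_minus_power s * ((1 - fps_X) * fps_deriv (one_minus_power (-s)))"
    by (simp add: algebra_simps)
  also have "\<dots> = 0" by (simp only: one_minus_power_ode) (simp add: algebra_simps flip: fps_const_neg)
  finally have "(1 - fps_X) * fps_deriv (one_minus_power s * one_minus_power (-s)) = 0" .
  moreover have "(1 - fps_X :: real fps) \<noteq> 0" by (metis diff_zero fps_X_nth fps_one_nth fps_sub_nth fps_zero_nth zero_neq_one)
  ultimately have "fps_deriv (one_minus_power s * one_minus_power (-s)) = 0" by simp
  from fps_deriv_eq_0D[OF this] show ?thesis by simp
qed

text \<open>
  Both sides solve the same hypergeometric equation: after multiplication by \<open>1 - X\<close>, the derivatives of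
  the power \<open>B\<close> of \<open>1 - X\<close> can be eliminated, and what remains is \<open>1 - X\<close> times \<open>B\<close> times the equation of the
  right-hand factor.
\<close>
lemma gauss_fps_euler_transformation:
  assumes "c > 0"
  shows "gauss_fps a b c = one_minus_power (c - a - b) * gauss_fps (c - a) (c - b) c"
proof -
  define s where "s = c - a - b"
  define B where "B = one_minus_power s"
  define H where "H = gauss_fps (c - a) (c - b) c"
  define X where "X = (fps_X :: real fps)"
  have X1: "1 - X \<noteq> 0" unfolding X_def by (metis diff_zero fps_X_nth fps_one_nth fps_sub_nth fps_zero_nth zero_neq_one)
  have B1: "(1 - X) * fps_deriv B = fps_const (-s) * B"
    unfolding B_def X_def by (rule one_minus_power_ode)
  have "fps_deriv ((1 - X) * fps_deriv B) = fps_deriv (fps_const (-s) * B)" by (simp only: B1)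
  then have B2: "(1 - X) * fps_deriv (fps_deriv B) = fps_const (1 - s) * fps_deriv B"
    unfolding X_def by (simp add: algebra_simps flip: fps_const_sub fps_const_neg) 
  have H: "X * (1 - X) * fps_deriv (fps_deriv H)
     + (fps_const c - fps_const (c - a + (c - b) + 1) * X) * fps_deriv H - fps_const ((c - a) * (c - b)) * H = 0"
    using hypergeometric_ode_gauss_fps[OF assms] unfolding H_def X_def hypergeometric_ode_def by blast
  have "(1 - X) * (X * (1 - X) * fps_deriv (fps_deriv (B * H))
     + (fps_const c - fps_const (a + b + 1) * X) * fps_deriv (B * H) - fps_const (a * b) * (B * H)) = 0"
    (is "?L = 0")
  proof -
    define b0 b1 b2 h0 h1 h2 where defs: "b0 = B" "b1 = fps_deriv B" "b2 = fps_deriv (fps_deriv B)"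
      "h0 = H" "h1 = fps_deriv H" "h2 = fps_deriv (fps_deriv H)"
    define fa fb fc where cs: "fa = fps_const a" "fb = fps_const b" "fc = fps_const c"
    have 1: "(1 - X) * b1 = - (fc - fa - fb) * b0"
      using B1 by (simp add: defs cs s_def flip: fps_const_sub)
    have 2: "(1 - X) * b2 = (1 - (fc - fa - fb)) * b1"
      using B2 by (simp add: defs cs s_def flip: fps_const_sub)
    have 3: "X * (1 - X) * h2 + (fc - (fc - fa + (fc - fb) + 1) * X) * h1 - ((fc - fa) * (fc - fb)) * h0 = 0"
      using H unfolding defs cs
      by (simp only: fps_const_add[symmetric] fps_const_sub[symmetric] fps_const_mult[symmetric] fps_const_1_eq_1)
    have "?L = (1 - X) * (X * (1 - X) * (b2 * h0 + 2 * b1 * h1 + b0 * h2)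
      + (fc - (fa + fb + 1) * X) * (b1 * h0 + b0 * h1) - fa * fb * (b0 * h0))"
      by (simp add: defs cs algebra_simps flip: fps_const_sub fps_const_add fps_const_mult)
    also have "\<dots> = 0" using 1 2 3 by algebra
    finally show ?thesis .
  qed
  then have "hypergeometric_ode a b c (B * H)"
    unfolding hypergeometric_ode_def X_def[symmetric] using X1 by (metis mult_eq_0_iff)
  then have "B * H = gauss_fps a b c"
    by (rule hypergeometric_ode_unique[OF assms]) (simp add: B_def H_def)
  then show ?thesis by (simp add: B_def H_def s_def)
qed

lemma gauss_fps1_rec:
  assumes "c > 0"
  shows "(c + real n) * gauss_fps 1 b c $ Suc n = (b + real n) * gauss_fps 1 b c $ n"
  using gauss_fps_rec[OF assms, of n 1 b] by (simp add: mult_ac add.commute)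

lemma gauss_fps2_nth: "gauss_fps 2 b c $ n = (real n + 1) * gauss_fps 1 b c $ n"
proof -
  have "(fps_X * fps_deriv (gauss_fps 1 b c)) $ n = (gauss_fps (1 + 1) b c - gauss_fps 1 b c) $ n"
    by (simp add: gauss_fps_euler_operator)
  then show ?thesis by (cases n) (simp_all add: algebra_simps)
qed

text \<open>
  Because one upper parameter is \<open>1\<close>, the series \<open>F(1,b;c)\<close> satisfies a first-order equation. Here it
  expresses \<open>F(2,b;c)\<close> through \<open>F(1,b;c)\<close> and thereby transports the analytic continuation.
\<close>
lemma gauss_fps2_linear:
  assumes "c > 0"
  shows "(1 - fps_X) * gauss_fps 2 b c = fps_const (c - 1) + (fps_const (2 - c) + fps_const (b - 1) * fps_X) * gauss_fps 1 b c"
proof (rule fps_ext)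
  fix n
  have e: "(1 - fps_X) * gauss_fps 2 b c = gauss_fps 2 b c - fps_X * gauss_fps 2 b c"
    "(fps_const (2 - c) + fps_const (b - 1) * fps_X) * gauss_fps 1 b c 
      = fps_const (2 - c) * gauss_fps 1 b c + fps_const (b - 1) * (fps_X * gauss_fps 1 b c)"
    by (simp_all add: algebra_simps)
  show "((1 - fps_X) * gauss_fps 2 b c) $ n
     = (fps_const (c - 1) + (fps_const (2 - c) + fps_const (b - 1) * fps_X) * gauss_fps 1 b c) $ n"
    unfolding e using gauss_fps1_rec[OF assms, of "n - 1" b]
    by (cases n) (simp_all add: gauss_fps2_nth algebra_simps)
qed

text \<open>
  The logarithmic derivative of \<open>F(2,b;c)\<close> in terms of the quotient \<open>F(1,b;c) / F(2,b;c)\<close>; at \<open>-1\<close> this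
  is the formula for the order of convexity.
\<close>
lemma gauss_fps2_deriv_linear:
  assumes "c > 0"
  shows "fps_X * (1 - fps_X) * fps_deriv (gauss_fps 2 b c)
     = (fps_const (2 - c) + fps_const b * fps_X) * gauss_fps 2 b c + fps_const (c - 2) * gauss_fps 1 b c"
proof (rule fps_ext)
  fix n
  have e: "fps_X * (1 - fps_X) * fps_deriv (gauss_fps 2 b c)
      = fps_X * fps_deriv (gauss_fps 2 b c) - fps_X * (fps_X * fps_deriv (gauss_fps 2 b c))"
    "(fps_const (2 - c) + fps_const b * fps_X) * gauss_fps 2 b c 
      = fps_const (2 - c) * gauss_fps 2 b c + fps_const b * (fps_X * gauss_fps 2 b c)"
    by (simp_all add: algebra_simps)
  show "(fps_X * (1 - fps_X) * fps_deriv (gauss_fps 2 b c)) $ n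
     = ((fps_const (2 - c) + fps_const b * fps_X) * gauss_fps 2 b c + fps_const (c - 2) * gauss_fps 1 b c) $ n"
  proof (cases n)
    case (Suc m)
    have "real (m + 1) * ((c + real m) * gauss_fps 1 b c $ Suc m) = real (m + 1) * ((b + real m) * gauss_fps 1 b c $ m)"
      by (simp only: gauss_fps1_rec[OF assms])
    then show ?thesis unfolding e Suc
      by (cases m) (simp_all add: gauss_fps2_nth algebra_simps)
  qed (simp add: e)
qed

lemma gauss_fps1_lower:
  assumes "c > 0"
  shows "gauss_fps 1 b c = 1 + fps_const (b / c) * fps_X * gauss_fps 1 (b + 1) (c + 1)"
  using gauss_fps_raise_first[OF assms, of 0 b] by (simp add: diff_eq_eq add.commute)

section \<open>Moment sequences from chain_coeff sequences\<close>

definition hankel_form :: "(nat \<Rightarrow> real) \<Rightarrow> nat \<Rightarrow> nat \<Rightarrow> (nat \<Rightarrow> real) \<Rightarrow> real" where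
  "hankel_form m s N q = (\<Sum>i<N. \<Sum>j<N. q i * q j * m (i + j + s))"

text \<open>
  If \<open>m n = \<integral> t\<^sup>n d\<mu>(t)\<close>, then \<open>hankel_form m s N q\<close> is \<open>\<integral> t\<^sup>s q(t)\<^sup>2 d\<mu>(t)\<close>, where \<open>q\<close> is the polynomial with coefficients
  \<open>q 0, \<dots>, q (N - 1)\<close>. The conditions say that the functional \<open>t\<^sup>n \<mapsto> m n\<close> behaves on squares like a
  probability measure on \<open>[0,1]\<close>; this is all that is used of the measure.
\<close>
definition hausdorff_moment :: "(nat \<Rightarrow> real) \<Rightarrow> bool" where
  "hausdorff_moment m \<longleftrightarrow> m 0 = 1 \<and>
     (\<forall>N q s. 0 \<le> hankel_form m (Suc s) N q \<and> hankel_form m (Suc s) N q \<le> hankel_form m s N q)"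

lemma hausdorff_moment_bounds:
  assumes "hausdorff_moment m"
  shows "0 \<le> m n" "m n \<le> 1"
proof -
  have step: "0 \<le> m (Suc s)" "m (Suc s) \<le> m s" for s
  proof -
    have "hankel_form m t 1 (\<lambda>_. 1) = m t" for t by (simp add: hankel_form_def)
    then show "0 \<le> m (Suc s)" "m (Suc s) \<le> m s"
      using assms unfolding hausdorff_moment_def by metis+
  qed
  have "m 0 = 1" using assms by (simp add: hausdorff_moment_def)
  then show "0 \<le> m n" by (cases n) (simp_all add: step)
  show "m n \<le> 1"
    by (induction n) (use \<open>m 0 = 1\<close> step(2) order_trans in \<open>auto\<close>)
qed

definition chain_coeff :: "(nat \<Rightarrow> real) \<Rightarrow> nat \<Rightarrow> real" where
  "chain_coeff g k = sqrt (1 - g (k - 1)) * sqrt (g k)"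

text \<open>
  A tridiagonal matrix with zero diagonal, acting on arbitrary real sequences. Only finitely supported
  ones occur below, so no completeness or summability is involved.
\<close>
definition jacobi :: "(nat \<Rightarrow> real) \<Rightarrow> (nat \<Rightarrow> real) \<Rightarrow> nat \<Rightarrow> real" where
  "jacobi g v k = (if k = 0 then 0 else chain_coeff g k * v (k - 1)) + chain_coeff g (Suc k) * v (Suc k)"

text \<open>
  A discrete Green formula: the truncated inner products differ only by a boundary term, which vanishes
  for sequences supported below \<open>N\<close>.
\<close>
lemma jacobi_symmetric:
  "(\<Sum>k\<le>N. u k * jacobi g w k - jacobi g u k * w k)
     = chain_coeff g (Suc N) * (u N * w (Suc N) - u (Suc N) * w N)"
  by (induction N) (auto simp: jacobi_def algebra_simps)

text \<open>
  By the Cauchy-Schwarz inequality with weights \<open>g k\<close> and \<open>1 - g k\<close>, the square of entry \<open>k\<close> is at most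
  \<open>(1 - g (k - 1)) (v (k - 1))\<^sup>2 + g (k + 1) (v (k + 1))\<^sup>2\<close>. Summed over \<open>k\<close>, every \<open>(v k)\<^sup>2\<close> receives the
  total weight \<open>(1 - g k) + g k = 1\<close>. The two boundary terms make the induction work.
\<close>
lemma jacobi_contraction:
  assumes g0: "g 0 = 0" and g: "\<And>k. 0 \<le> g k \<and> g k \<le> 1"
  shows "(\<Sum>k\<le>N. (jacobi g v k)\<^sup>2) \<le> (\<Sum>k<N. (v k)\<^sup>2) + g N * (v N)\<^sup>2 + g (Suc N) * (v (Suc N))\<^sup>2"
proof (induction N)
  case 0
  have "(jacobi g v 0)\<^sup>2 = g 1 * (v 1)\<^sup>2"
    using g[of 1] by (simp add: jacobi_def chain_coeff_def g0 power_mult_distrib)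
  then show ?case by (simp add: g0)
next
  case (Suc N)
  have cs: "(sqrt p * a + sqrt (1 - p) * b)\<^sup>2 \<le> a\<^sup>2 + b\<^sup>2" if "0 \<le> p" "p \<le> 1" for p a b :: real
  proof -
    have "0 \<le> (sqrt (1 - p) * a - sqrt p * b)\<^sup>2" by simp
    also have "\<dots> = (1 - p) * a\<^sup>2 + p * b\<^sup>2 - 2 * (sqrt p * a) * (sqrt (1 - p) * b)"
      using that by (simp add: power2_diff power_mult_distrib)
    finally show ?thesis
      using that by (simp add: power2_sum power_mult_distrib algebra_simps)
  qed
  have "jacobi g v (Suc N) = sqrt (g (Suc N)) * (sqrt (1 - g N) * v N)
      + sqrt (1 - g (Suc N)) * (sqrt (g (Suc (Suc N))) * v (Suc (Suc N)))"
    by (simp add: jacobi_def chain_coeff_def)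
  then have "(jacobi g v (Suc N))\<^sup>2 \<le> (sqrt (1 - g N) * v N)\<^sup>2 + (sqrt (g (Suc (Suc N))) * v (Suc (Suc N)))\<^sup>2"
    using cs g by metis
  also have "\<dots> = (1 - g N) * (v N)\<^sup>2 + g (Suc (Suc N)) * (v (Suc (Suc N)))\<^sup>2"
    using g by (simp add: power_mult_distrib)
  finally show ?case using Suc by (simp add: algebra_simps)
qed

fun jacobi_vec :: "(nat \<Rightarrow> real) \<Rightarrow> nat \<Rightarrow> nat \<Rightarrow> real" where
  "jacobi_vec g 0 = (\<lambda>k. if k = 0 then 1 else 0)"
| "jacobi_vec g (Suc n) = jacobi g (jacobi_vec g n)"

lemma jacobi_vec_support: "n < k \<Longrightarrow> jacobi_vec g n k = 0"
  by (induction n arbitrary: k) (auto simp: jacobi_def)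

text \<open>
  Symmetry moves all powers of the operator to one side, so the Gram matrix of the iterates of \<open>e\<^sub>0\<close> is
  a Hankel matrix.
\<close>
lemma jacobi_vec_inner:
  "i + j \<le> N \<Longrightarrow> (\<Sum>k\<le>N. jacobi_vec g i k * jacobi_vec g j k) = jacobi_vec g (i + j) 0"
proof (induction i arbitrary: j)
  case 0
  have "(\<Sum>k\<le>N. jacobi_vec g 0 k * jacobi_vec g j k) = (\<Sum>k\<in>{0}. jacobi_vec g 0 k * jacobi_vec g j k)"
    by (rule sum.mono_neutral_right) auto
  then show ?case by simp
next
  case (Suc i)
  have "(\<Sum>k\<le>N. jacobi_vec g i k * jacobi_vec g (Suc j) k - jacobi_vec g (Suc i) k * jacobi_vec g j k) = 0"
    using Suc.prems by (simp add: jacobi_symmetric jacobi_vec_support)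
  then have "(\<Sum>k\<le>N. jacobi_vec g (Suc i) k * jacobi_vec g j k)
      = (\<Sum>k\<le>N. jacobi_vec g i k * jacobi_vec g (Suc j) k)"
    by (simp add: sum_subtractf)
  also have "\<dots> = jacobi_vec g (i + Suc j) 0" using Suc.prems by (intro Suc.IH) simp
  finally show ?case by simp
qed

lemma jacobi_sum: "jacobi g (\<lambda>k. \<Sum>i\<in>A. q i * v i k) k = (\<Sum>i\<in>A. q i * jacobi g (v i) k)"
  by (cases k) (auto simp: jacobi_def sum_distrib_left sum.distrib algebra_simps)

text \<open>
  The Hankel form with shift \<open>s\<close> is the squared norm of \<open>S\<^sup>s v\<close> with \<open>v = \<Sum>i. q i S\<^bsup>2i\<^esup> e\<^sub>0\<close>. Hence it is
  nonnegative, and it decreases in \<open>s\<close> because \<open>S\<close> is a contraction.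
\<close>
lemma jacobi_moments_hausdorff:
  assumes g0: "g 0 = 0" and g: "\<And>k. 0 \<le> g k \<and> g k \<le> 1"
  shows "hausdorff_moment (\<lambda>n. jacobi_vec g (2 * n) 0)"
proof -
  define m where "m = (\<lambda>n. jacobi_vec g (2 * n) 0)"
  define V where "V = (\<lambda>N q s k. \<Sum>i<N. q i * jacobi_vec g (2 * i + s) k)"
  have form: "hankel_form m s N q = (\<Sum>k\<le>M. (V N q s k)\<^sup>2)" if M: "4 * N + 2 * s \<le> M" for s N q M
  proof -
    have "(\<Sum>k\<le>M. (V N q s k)\<^sup>2)
       = (\<Sum>k\<le>M. \<Sum>i<N. \<Sum>j<N. q i * q j * (jacobi_vec g (2 * i + s) k * jacobi_vec g (2 * j + s) k))"
      by (simp add: V_def power2_eq_square sum_product mult_ac)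
    also have "\<dots> = (\<Sum>i<N. \<Sum>k\<le>M. \<Sum>j<N. q i * q j * (jacobi_vec g (2 * i + s) k * jacobi_vec g (2 * j + s) k))"
      by (rule sum.swap)
    also have "\<dots> = (\<Sum>i<N. \<Sum>j<N. \<Sum>k\<le>M. q i * q j * (jacobi_vec g (2 * i + s) k * jacobi_vec g (2 * j + s) k))"
      by (rule sum.cong[OF refl], rule sum.swap)
    also have "\<dots> = (\<Sum>i<N. \<Sum>j<N. q i * q j * m (i + j + s))"
    proof (intro sum.cong refl)
      fix i j assume "i \<in> {..<N}" "j \<in> {..<N}"
      then have "(\<Sum>k\<le>M. jacobi_vec g (2 * i + s) k * jacobi_vec g (2 * j + s) k)
          = jacobi_vec g ((2 * i + s) + (2 * j + s)) 0"
        using M by (intro jacobi_vec_inner) auto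
      moreover have "(2 * i + s) + (2 * j + s) = 2 * (i + j + s)" by simp
      ultimately show "(\<Sum>k\<le>M. q i * q j * (jacobi_vec g (2 * i + s) k * jacobi_vec g (2 * j + s) k))
          = q i * q j * m (i + j + s)"
        by (simp add: m_def flip: sum_distrib_left)
    qed
    finally show ?thesis by (simp add: hankel_form_def)
  qed
  have VS: "V N q (Suc s) = jacobi g (V N q s)" for N q s
    by (rule ext) (simp add: V_def jacobi_sum)
  have "0 \<le> hankel_form m (Suc s) N q \<and> hankel_form m (Suc s) N q \<le> hankel_form m s N q" for N q s
  proof -
    define M where "M = 4 * N + 2 * s + 2"
    have z: "V N q s k = 0" if "k \<ge> M" for k
      unfolding V_def using that by (intro sum.neutral) (auto simp: jacobi_vec_support M_def)
    have "hankel_form m (Suc s) N q = (\<Sum>k\<le>M. (jacobi g (V N q s) k)\<^sup>2)"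
      using form[where N = N and s = "Suc s" and M = M and q = q] by (simp add: M_def VS)
    also have "\<dots> \<le> (\<Sum>k<M. (V N q s k)\<^sup>2)"
      using jacobi_contraction[where g = g, OF g0 g, of "V N q s" M] by (simp add: z)
    also have "\<dots> = (\<Sum>k\<le>M. (V N q s k)\<^sup>2)" by (simp add: z flip: lessThan_Suc_atMost)
    also have "\<dots> = hankel_form m s N q" using form[where N = N and s = s and M = M and q = q] by (simp add: M_def)
    finally have "hankel_form m (Suc s) N q \<le> hankel_form m s N q" .
    moreover have "0 \<le> hankel_form m (Suc s) N q"
      using form[where N = N and s = "Suc s" and M = M and q = q] by (simp add: M_def sum_nonneg)
    ultimately show ?thesis by blast
  qed
  then show ?thesis by (auto simp: hausdorff_moment_def m_def)
qed

lemma chain_coeff_square: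
  assumes "0 \<le> g k" "g (k - 1) \<le> 1"
  shows "chain_coeff g k * chain_coeff g k = (1 - g (k - 1)) * g k"
  using assms by (simp add: chain_coeff_def algebra_simps)

text \<open>
  The recursions say that \<open>P 0 / Q\<close> is the continued fraction with partial numerators
  \<open>a\<^sub>k = (1 - g\<^sub>k\<^sub>-\<^sub>1) g\<^sub>k\<close>. The quotients \<open>r\<^sub>k = P k / Q\<close> solve the resolvent equation of the Jacobi operator: up to the
  factor \<open>sqrt (a\<^sub>1 \<dots> a\<^sub>k)\<close>, coefficient \<open>j\<close> of \<open>r\<^sub>k\<close> is entry \<open>k\<close> of the iterate of \<open>e\<^sub>0\<close> with index
  \<open>k + 2 j\<close>.
\<close>
lemma continued_fraction_hausdorff:
  fixes Q :: "real fps" and P :: "nat \<Rightarrow> real fps"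
  assumes g0: "g 0 = 0" and g: "\<And>k. 0 \<le> g k \<and> g k \<le> 1"
    and c0: "\<And>n. P n $ 0 = 1" "Q $ 0 = 1"
    and Q: "Q = P 0 - fps_const (g 1) * fps_X * P 1"
    and P: "\<And>n. P n = P (Suc n) - fps_const ((1 - g (Suc n)) * g (Suc (Suc n))) * fps_X * P (Suc (Suc n))"
  shows "\<exists>f. hausdorff_moment (fps_nth f) \<and> P 0 = f * Q"
proof -
  define r where "r n = P n * inverse Q" for n
  have QQ: "Q * inverse Q = 1" using inverse_mult_eq_1'[of Q] c0(2) by simp
  define a where "a k = (1 - g (k - 1)) * g k" for k
  have r0: "r 0 = 1 + fps_const (a 1) * (fps_X * r 1)"
  proof -
    have "P 0 = Q + fps_const (g 1) * fps_X * P 1" using Q by (simp add: algebra_simps)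
    then have "r 0 = Q * inverse Q + fps_const (g 1) * fps_X * (P 1 * inverse Q)"
      by (simp add: r_def algebra_simps)
    then show ?thesis by (simp add: QQ a_def g0 r_def mult.assoc)
  qed
  have rS: "r (Suc n) = r n + fps_const (a (Suc (Suc n))) * (fps_X * r (Suc (Suc n)))" for n
  proof -
    have "r n = (P (Suc n) - fps_const (a (Suc (Suc n))) * fps_X * P (Suc (Suc n))) * inverse Q"
      using P[of n] by (simp add: r_def a_def)
    then show ?thesis by (simp add: r_def algebra_simps)
  qed
  have rn0: "r n $ 0 = 1" for n using c0 by (simp add: r_def)
  define s where "s k = (\<Prod>i<k. chain_coeff g (Suc i))" for k
  have ch: "chain_coeff g (Suc k) * chain_coeff g (Suc k) = a (Suc k)" for k
    using chain_coeff_square[of g "Suc k"] g by (simp add: a_def)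
  have main: "k + 2 * j = n \<Longrightarrow> jacobi_vec g n k = s k * r k $ j" for k j n
  proof (induction n arbitrary: k j)
    case 0
    then show ?case by (simp add: s_def rn0)
  next
    case (Suc n)
    \<comment> \<open>The entry above enters with a shift of the coefficient index, which is where the factor \<open>X\<close> in
        the recursion of \<open>r\<close> comes from; at \<open>j = 0\<close> it lies outside the support.\<close>
    have up: "chain_coeff g (Suc k) * jacobi_vec g n (Suc k)
        = s k * (if j = 0 then 0 else a (Suc k) * r (Suc k) $ (j - 1))"
    proof (cases j)
      case 0
      then show ?thesis using Suc.prems by (simp add: jacobi_vec_support)
    next
      case (Suc i)
      then have "jacobi_vec g n (Suc k) = s (Suc k) * r (Suc k) $ i"
        using Suc.prems by (intro Suc.IH) auto
      then show ?thesis using Suc ch[of k] by (simp add: s_def mult_ac)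
    qed
    show ?case
    proof (cases k)
      case 0
      then obtain i where j: "j = Suc i" using Suc.prems by (cases j) auto
      have "r 0 $ j = a 1 * r 1 $ i" unfolding r0 by (simp add: j)
      then show ?thesis using up by (simp add: 0 j jacobi_def)
    next
      case (Suc l)
      have "jacobi_vec g n l = s l * r l $ j" using Suc.prems Suc by (intro Suc.IH) auto
      then have "chain_coeff g k * jacobi_vec g n l = s k * r l $ j" by (simp add: Suc s_def mult_ac)
      moreover have "r (Suc l) $ j = r l $ j + (if j = 0 then 0 else a (Suc k) * r (Suc k) $ (j - 1))"
        unfolding rS[of l] by (cases j) (auto simp: Suc)
      ultimately show ?thesis using up by (simp add: Suc jacobi_def algebra_simps)
    qed
  qed
  have "fps_nth (r 0) = (\<lambda>n. jacobi_vec g (2 * n) 0)"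
    using main[of 0] by (auto simp: s_def)
  moreover have "P 0 = r 0 * Q" using QQ by (simp add: r_def mult.assoc mult.commute)
  ultimately show ?thesis using jacobi_moments_hausdorff[where g = g, OF g0 g] by metis
qed

section \<open>The quotient F(a+1,b;c) / F(a,b;c)\<close>

text \<open>
  In the continued fraction of Gauss one has \<open>g\<^bsub>2l+1\<^esub> = (b + l) / (c + 2 l)\<close> and
  \<open>g\<^bsub>2l\<^esub> = (a + l) / (c + 2 l - 1)\<close>; they lie in \<open>[0,1]\<close> because
  \<open>0 \<le> a \<le> c\<close> and \<open>0 < b \<le> c\<close>.
\<close>
lemma gauss_fps_ratio_hausdorff:
  assumes "0 \<le> a" "a \<le> c" "0 < b" "b \<le> c"
  shows "\<exists>f. hausdorff_moment (fps_nth f) \<and> gauss_fps (a + 1) b c = f * gauss_fps a b c"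
proof -
  \<comment> \<open>Each step raises \<open>c\<close> by one and, alternately, \<open>b\<close> or \<open>a\<close>.\<close>
  define P where "P n = (if even n then gauss_fps (a + real (n div 2) + 1) (b + real (n div 2)) (c + real n)
     else gauss_fps (a + real (n div 2) + 1) (b + real (n div 2) + 1) (c + real n))" for n
  define g where "g n = (if n = 0 then 0 else if even n then (a + real (n div 2)) / (c + real n - 1)
     else (b + real (n div 2)) / (c + real n - 1))" for n
  have c: "c > 0" using assms by simp
  have g01: "0 \<le> g k \<and> g k \<le> 1" for k
  proof (cases "k = 0")
    case False
    then have "c + real k - 1 > 0" using c by linarith
    moreover have "a + real (k div 2) \<le> c + real k - 1" if "even k" 
    proof -
      from that False obtain l where l: "k = 2 * l" "l \<ge> 1" by (metis dvd_def less_one not_le mult_zero_right)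
      then show ?thesis using assms by simp
    qed
    moreover have "b + real (k div 2) \<le> c + real k - 1" if "odd k"
    proof -
      from that obtain l where l: "k = 2 * l + 1" by (metis oddE)
      then show ?thesis using assms by simp
    qed
    ultimately show ?thesis using assms by (auto simp: g_def)
  qed (simp add: g_def)
  have Q: "gauss_fps a b c = P 0 - fps_const (g 1) * fps_X * P 1"
    using gauss_fps_raise_first[OF c, of a b] by (simp add: P_def g_def algebra_simps)
  have P: "P n = P (Suc n) - fps_const ((1 - g (Suc n)) * g (Suc (Suc n))) * fps_X * P (Suc (Suc n))" for n
  proof (cases "even n")
    case True
    then obtain l where n: "n = 2 * l" by blast
    have "(1 - g (Suc n)) * g (Suc (Suc n))
        = (a + real l + 1) * (c + real n - (b + real l)) / ((c + real n) * (c + real n + 1))"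
      using c by (simp add: g_def n field_simps)
    moreover have "P n = gauss_fps (a + real l + 1) (b + real l) (c + real n)"
      "P (Suc n) = gauss_fps (a + real l + 1) (b + real l + 1) (c + real n + 1)"
      "P (Suc (Suc n)) = gauss_fps (a + real l + 1 + 1) (b + real l + 1) (c + real n + 2)"
      by (simp_all add: P_def n add_ac)
    ultimately show ?thesis
      using gauss_fps_gauss_second[of "c + real n" "a + real l + 1" "b + real l"] c by simp
  next
    case False
    then obtain l where n: "n = 2 * l + 1" using oddE by blast
    have "(1 - g (Suc n)) * g (Suc (Suc n))
        = (b + real l + 1) * (c + real n - (a + real l + 1)) / ((c + real n) * (c + real n + 1))"
      using c by (simp add: g_def n field_simps)
    moreover have "P n = gauss_fps (a + real l + 1) (b + real l + 1) (c + real n)"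
      "P (Suc n) = gauss_fps (a + real l + 1 + 1) (b + real l + 1) (c + real n + 1)"
      "P (Suc (Suc n)) = gauss_fps (a + real l + 1 + 1) (b + real l + 1 + 1) (c + real n + 2)"
      by (simp_all add: P_def n add_ac)
    ultimately show ?thesis
      using gauss_fps_gauss_first[of "c + real n" "a + real l + 1" "b + real l + 1"] c by simp
  qed
  have "\<exists>f. hausdorff_moment (fps_nth f) \<and> P 0 = f * gauss_fps a b c"
    using continued_fraction_hausdorff[of g P "gauss_fps a b c", OF _ g01 _ _ Q P]
    by (simp add: P_def g_def)
  then show ?thesis by (simp add: P_def)
qed

section \<open>Real parts of Hausdorff moment series\<close>

definition complex_fps :: "real fps \<Rightarrow> complex fps" where
  "complex_fps f = Abs_fps (\<lambda>n. of_real (f $ n))"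

lemma complex_fps_nth [simp]: "complex_fps f $ n = of_real (f $ n)"
  by (simp add: complex_fps_def)

definition geometric :: "complex \<Rightarrow> complex fps" where
  "geometric w = Abs_fps (\<lambda>n. w ^ n)"

lemma geometric_inverse: "(1 - fps_const w * fps_X) * geometric w = 1"
proof (rule fps_ext)
  fix n show "((1 - fps_const w * fps_X) * geometric w) $ n = 1 $ n"
    by (cases n) (auto simp: geometric_def ring_distribs mult.assoc)
qed

definition cnj_fps :: "complex fps \<Rightarrow> complex fps" where
  "cnj_fps K = Abs_fps (\<lambda>n. cnj (K $ n))"

lemma cnj_fps_mult: "cnj_fps (A * B) = cnj_fps A * cnj_fps B"
  by (rule fps_ext) (simp add: cnj_fps_def fps_mult_nth)

lemma cnj_fps_geometric: "cnj_fps (geometric w) = geometric (cnj w)"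
  by (simp add: cnj_fps_def geometric_def)

definition abs_summable_fps :: "complex fps \<Rightarrow> bool" where
  "abs_summable_fps h \<longleftrightarrow> summable (\<lambda>n. norm (h $ n))"

lemma abs_summable_fps_mult:
  assumes "abs_summable_fps A" "abs_summable_fps B"
  shows "abs_summable_fps (A * B)"
proof -
  have "summable (\<lambda>n. \<Sum>i\<le>n. norm (A $ i) * norm (B $ (n - i)))"
    using summable_Cauchy_product[of "\<lambda>n. norm (A $ n)" "\<lambda>n. norm (B $ n)"] assms
    by (simp add: abs_summable_fps_def)
  then show ?thesis unfolding abs_summable_fps_def
    by (rule summable_comparison_test')
       (simp add: fps_mult_nth atLeast0AtMost order_trans[OF norm_sum] norm_mult)
qed

lemma abs_summable_fps_add:
  "abs_summable_fps A \<Longrightarrow> abs_summable_fps B \<Longrightarrow> abs_summable_fps (A + B)"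
  unfolding abs_summable_fps_def
  by (rule summable_comparison_test'[OF summable_add, of "\<lambda>n. norm (A $ n)" "\<lambda>n. norm (B $ n)" 0])
     (auto intro: norm_triangle_ineq)

lemma abs_summable_fps_finite: "(\<And>n. n \<ge> N \<Longrightarrow> h $ n = 0) \<Longrightarrow> abs_summable_fps h"
  unfolding abs_summable_fps_def by (rule summable_finite[of "{..<N}"]) (auto simp: not_less)

lemma abs_summable_fps_const: "abs_summable_fps (fps_const k)"
  by (rule abs_summable_fps_finite[of 1]) simp

lemma abs_summable_fps_X_power: "abs_summable_fps (fps_X ^ n)"
  by (rule abs_summable_fps_finite[of "Suc n"]) (simp add: fps_X_power_nth)

lemma abs_summable_fps_geometric: "norm w < 1 \<Longrightarrow> abs_summable_fps (geometric w)"
  by (simp add: abs_summable_fps_def geometric_def norm_power summable_geometric)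

text \<open>
  The triangle \<open>i + j < N\<close> gives the partial sums of the Cauchy product. The sum over the rest of the
  square tends to zero since it does so for the absolute values.
\<close>
lemma square_sum_limit:
  fixes a b :: "nat \<Rightarrow> complex" and m :: "nat \<Rightarrow> real"
  assumes a: "summable (\<lambda>n. norm (a n))" and b: "summable (\<lambda>n. norm (b n))"
    and m: "\<And>n. \<bar>m n\<bar> \<le> 1"
  shows "(\<lambda>N. \<Sum>i<N. \<Sum>j<N. a i * b j * of_real (m (i + j)))
           \<longlonglongrightarrow> (\<Sum>n. (\<Sum>i\<le>n. a i * b (n - i)) * of_real (m n))"
proof -
  define h where "h = (\<lambda>(i, j). a i * b j * of_real (m (i + j)))"
  define k where "k = (\<lambda>(i, j). norm (a i) * norm (b j))"
  define S where "S N = {..<N} \<times> {..<N}" for N :: nat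
  define T where "T N = {(i, j). i + j < N}" for N :: nat
  have TS: "T N \<subseteq> S N" and fS: "finite (S N)" for N by (auto simp: S_def T_def)
  have hk: "norm (h p) \<le> k p" for p
    using mult_left_mono[OF m, of "norm (a (fst p)) * norm (b (snd p))"]
    by (auto simp: h_def k_def norm_mult split: prod.splits)
  have kS: "sum k (S N) = (\<Sum>i<N. norm (a i)) * (\<Sum>j<N. norm (b j))" for N
    by (simp add: S_def k_def sum.cartesian_product sum_product)
  have kT: "sum k (T N) = (\<Sum>n<N. \<Sum>i\<le>n. norm (a i) * norm (b (n - i)))" for N
    unfolding T_def k_def by (rule sum.triangle_reindex)
  have hS: "sum h (S N) = (\<Sum>i<N. \<Sum>j<N. a i * b j * of_real (m (i + j)))" for N
    by (simp add: S_def h_def sum.cartesian_product)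
  have hT: "sum h (T N) = (\<Sum>n<N. (\<Sum>i\<le>n. a i * b (n - i)) * of_real (m n))" for N
    unfolding T_def h_def by (subst sum.triangle_reindex) (simp add: sum_distrib_right)
  have cp: "(\<lambda>n. \<Sum>i\<le>n. norm (a i) * norm (b (n - i))) sums ((\<Sum>n. norm (a n)) * (\<Sum>n. norm (b n)))"
    using Cauchy_product_sums[of "\<lambda>n. norm (a n)" "\<lambda>n. norm (b n)"] a b by simp
  have "(\<lambda>N. sum k (S N) - sum k (T N)) \<longlonglongrightarrow>
      (\<Sum>n. norm (a n)) * (\<Sum>n. norm (b n)) - (\<Sum>n. norm (a n)) * (\<Sum>n. norm (b n))"
    unfolding kS kT using cp a b
    by (intro tendsto_diff tendsto_mult summable_LIMSEQ) (auto simp: sums_def)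
  then have k0: "(\<lambda>N. sum k (S N) - sum k (T N)) \<longlonglongrightarrow> 0" by simp
  have d0: "(\<lambda>N. sum h (S N) - sum h (T N)) \<longlonglongrightarrow> 0"
  proof (rule Lim_null_comparison[OF _ k0], rule always_eventually, rule allI)
    fix N
    have "sum h (S N) - sum h (T N) = sum h (S N - T N)"
      using sum_diff[OF fS TS] by metis
    also have "norm \<dots> \<le> sum k (S N - T N)" by (rule sum_norm_le) (rule hk)
    also have "\<dots> = sum k (S N) - sum k (T N)" using sum_diff[OF fS TS] by metis
    finally show "norm (sum h (S N) - sum h (T N)) \<le> sum k (S N) - sum k (T N)" .
  qed
  have "summable (\<lambda>n. (\<Sum>i\<le>n. a i * b (n - i)) * of_real (m n))"
  proof (rule summable_comparison_test'[OF sums_summable[OF cp]])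
    fix n
    have "norm ((\<Sum>i\<le>n. a i * b (n - i)) * of_real (m n)) \<le> norm (\<Sum>i\<le>n. a i * b (n - i)) * 1"
      unfolding norm_mult using m by (intro mult_left_mono) auto
    also have "\<dots> \<le> (\<Sum>i\<le>n. norm (a i) * norm (b (n - i)))"
      using norm_sum[of "\<lambda>i. a i * b (n - i)" "{..n}"] by (simp add: norm_mult)
    finally show "norm ((\<Sum>i\<le>n. a i * b (n - i)) * of_real (m n)) \<le> (\<Sum>i\<le>n. norm (a i) * norm (b (n - i)))" .
  qed
  then have "(\<lambda>N. sum h (T N)) \<longlonglongrightarrow> (\<Sum>n. (\<Sum>i\<le>n. a i * b (n - i)) * of_real (m n))"
    unfolding hT by (rule summable_LIMSEQ)
  from tendsto_add[OF d0 this] show ?thesis by (simp add: hS)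
qed

text \<open>
  The functional \<open>t\<^sup>n \<mapsto> m n\<close>, extended from polynomials to absolutely summable series in \<open>t\<close>.
\<close>
definition moment_functional :: "(nat \<Rightarrow> real) \<Rightarrow> complex fps \<Rightarrow> complex" where
  "moment_functional m h = (\<Sum>n. h $ n * of_real (m n))"

lemma moment_functional_summable:
  assumes "hausdorff_moment m" "abs_summable_fps h"
  shows "summable (\<lambda>n. h $ n * of_real (m n))"
proof (rule summable_comparison_test'[OF assms(2)[unfolded abs_summable_fps_def]])
  fix n show "norm (h $ n * of_real (m n)) \<le> norm (h $ n)"
    using hausdorff_moment_bounds[OF assms(1)] by (simp add: norm_mult mult_left_le)
qed

lemma moment_functional_add:
  assumes "hausdorff_moment m" "abs_summable_fps g" "abs_summable_fps h"
  shows "moment_functional m (g + h) = moment_functional m g + moment_functional m h"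
  using moment_functional_summable[OF assms(1)] assms
  by (simp add: moment_functional_def suminf_add ring_distribs)

lemma moment_functional_cmult:
  assumes "hausdorff_moment m" "abs_summable_fps h"
  shows "moment_functional m (fps_const k * h) = k * moment_functional m h"
  using moment_functional_summable[OF assms]
  by (simp add: moment_functional_def suminf_mult mult.assoc)

lemma moment_functional_cnj:
  assumes "hausdorff_moment m" "abs_summable_fps h"
  shows "moment_functional m (cnj_fps h) = cnj (moment_functional m h)"
proof -
  have "(\<lambda>n. h $ n * of_real (m n)) sums moment_functional m h"
    using moment_functional_summable[OF assms] by (simp add: moment_functional_def summable_sums)
  then have "(\<lambda>n. cnj (h $ n * of_real (m n))) sums cnj (moment_functional m h)"
    by (simp only: sums_cnj)
  then show ?thesis by (simp add: moment_functional_def cnj_fps_def sums_iff)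
qed

text \<open>
  The kernel \<open>1 / (1 - t w)\<close>, expanded in powers of \<open>t\<close>, represents evaluation at \<open>w\<close>.
\<close>
lemma moment_functional_geometric:
  "moment_functional (fps_nth f) (geometric w) = eval_fps (complex_fps f) w"
  by (simp add: moment_functional_def geometric_def eval_fps_def mult.commute)

lemma moment_functional_square_limit:
  assumes m: "hausdorff_moment m" and K: "abs_summable_fps K"
  shows "(\<lambda>N. hankel_form m s N (\<lambda>i. Re (K $ i)) + hankel_form m s N (\<lambda>i. Im (K $ i)))
           \<longlonglongrightarrow> Re (moment_functional m (fps_X ^ s * (K * cnj_fps K)))"
proof -
  have b: "\<bar>m (n + s)\<bar> \<le> 1" for n using hausdorff_moment_bounds[OF m] by simp
  have "(\<lambda>N. \<Sum>i<N. \<Sum>j<N. K $ i * cnj (K $ j) * of_real (m (i + j + s)))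
          \<longlonglongrightarrow> (\<Sum>n. (\<Sum>i\<le>n. K $ i * cnj (K $ (n - i))) * of_real (m (n + s)))"
    using square_sum_limit[of "\<lambda>n. K $ n" "\<lambda>n. cnj (K $ n)" "\<lambda>n. m (n + s)"] K b
    by (simp add: abs_summable_fps_def)
  then have "(\<lambda>N. Re (\<Sum>i<N. \<Sum>j<N. K $ i * cnj (K $ j) * of_real (m (i + j + s))))
          \<longlonglongrightarrow> Re (\<Sum>n. (\<Sum>i\<le>n. K $ i * cnj (K $ (n - i))) * of_real (m (n + s)))"
    by (rule tendsto_Re)
  moreover have "Re (\<Sum>i<N. \<Sum>j<N. K $ i * cnj (K $ j) * of_real (m (i + j + s)))
      = hankel_form m s N (\<lambda>i. Re (K $ i)) + hankel_form m s N (\<lambda>i. Im (K $ i))" for N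
    by (simp add: hankel_form_def ring_distribs sum.distrib)
  moreover have "(\<Sum>n. (\<Sum>i\<le>n. K $ i * cnj (K $ (n - i))) * of_real (m (n + s)))
     = moment_functional m (fps_X ^ s * (K * cnj_fps K))"
  proof -
    define F where "F n = (fps_X ^ s * (K * cnj_fps K)) $ n * of_real (m n)" for n
    have "(\<lambda>n. F (n + s)) sums x \<longleftrightarrow> F sums x" for x
      by (rule sums_zero_iff_shift) (simp add: F_def fps_X_power_mult_nth)
    then have "suminf (\<lambda>n. F (n + s)) = suminf F" by (simp add: suminf_def)
    moreover have "F (n + s) = (\<Sum>i\<le>n. K $ i * cnj (K $ (n - i))) * of_real (m (n + s))" for n
      unfolding F_def fps_X_power_mult_nth by (simp add: fps_mult_nth cnj_fps_def atLeast0AtMost)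
    moreover have "moment_functional m (fps_X ^ s * (K * cnj_fps K)) = suminf F"
      by (simp only: moment_functional_def F_def[abs_def])
    ultimately show ?thesis by (simp only:)
  qed
  ultimately show ?thesis by simp
qed

text \<open>
  Positivity on \<open>t\<^sup>s |K(t)|\<^sup>2\<close> and on \<open>t\<^sup>s (1 - t) |K(t)|\<^sup>2\<close>, obtained from real polynomials by splitting \<open>K\<close> into real
  and imaginary parts and passing to the limit.
\<close>
lemma moment_functional_square_mono:
  assumes "hausdorff_moment m" and K: "abs_summable_fps K"
  shows "0 \<le> Re (moment_functional m (fps_X ^ s * (K * cnj_fps K)))"
    and "Re (moment_functional m (fps_X ^ Suc s * (K * cnj_fps K)))
           \<le> Re (moment_functional m (fps_X ^ s * (K * cnj_fps K)))"
proof -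
  have le: "0 \<le> hankel_form m (Suc s) N q" "hankel_form m (Suc s) N q \<le> hankel_form m s N q" for N q
    using assms(1) by (auto simp: hausdorff_moment_def)
  then have nonneg: "0 \<le> hankel_form m s N q" for N q by (meson order_trans)
  show "0 \<le> Re (moment_functional m (fps_X ^ s * (K * cnj_fps K)))"
    by (rule LIMSEQ_le_const[OF moment_functional_square_limit[OF assms]]) (simp add: nonneg add_nonneg_nonneg)
  show "Re (moment_functional m (fps_X ^ Suc s * (K * cnj_fps K)))
           \<le> Re (moment_functional m (fps_X ^ s * (K * cnj_fps K)))"
    by (rule LIMSEQ_le[OF moment_functional_square_limit[OF assms] moment_functional_square_limit[OF assms]])
       (auto intro!: exI[of _ 0] add_mono le)
qed

text \<open>
  The kernel identity is \<open>2 Re (1 / (1 - t z)) - 1 = (1 - |z|\<^sup>2 t\<^sup>2) |1 / (1 - t z)|\<^sup>2\<close>, and the functional is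
  nonnegative on the right-hand side.
\<close>
lemma hausdorff_Re_ge_half:
  assumes f: "hausdorff_moment (fps_nth f)" and z: "norm z < 1"
  shows "Re (eval_fps (complex_fps f) z) \<ge> 1 / 2"
proof -
  define K where "K = geometric z"
  define L where "L = moment_functional (fps_nth f)"
  define A where "A s = Re (L (fps_X ^ s * (K * cnj_fps K)))" for s
  have sK: "abs_summable_fps K" "abs_summable_fps (geometric (cnj z))"
    using z by (simp_all add: K_def abs_summable_fps_geometric)
  have sKK: "abs_summable_fps (fps_X ^ s * (K * cnj_fps K))" for s
    using sK by (simp add: K_def cnj_fps_geometric abs_summable_fps_mult abs_summable_fps_X_power)
  have A: "A (Suc s) \<le> A s" "0 \<le> A s" for s
    using moment_functional_square_mono[OF f sK(1)] by (simp_all only: A_def L_def)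
  have nz: "(of_real (norm z))\<^sup>2 = z * cnj z" using complex_norm_square by simp
  have id: "fps_X ^ 0 * (K * cnj_fps K) + fps_const (- (of_real (norm z))\<^sup>2) * (fps_X ^ 2 * (K * cnj_fps K))
     = geometric z + geometric (cnj z) + fps_const (-1)"
  proof -
    have 1: "(1 - fps_const z * fps_X) * K = 1"
      and 2: "(1 - fps_const (cnj z) * fps_X) * cnj_fps K = 1"
      by (simp_all add: K_def geometric_inverse cnj_fps_geometric)
    have "(K * cnj_fps K) - fps_const z * fps_const (cnj z) * fps_X ^ 2 * (K * cnj_fps K) = K + cnj_fps K - 1"
      using 1 2 by algebra
    then show ?thesis by (simp add: nz K_def cnj_fps_geometric mult.assoc flip: fps_const_neg fps_const_mult)
  qed
  have "L (fps_X ^ 0 * (K * cnj_fps K)) + (- (of_real (norm z))\<^sup>2) * L (fps_X ^ 2 * (K * cnj_fps K))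
     = L (geometric z) + L (geometric (cnj z)) + (-1)"
  proof -
    have "L (fps_const (-1)) = -1"
    proof -
      have "(\<lambda>n. fps_const (-1) $ n * of_real (f $ n)) sums (\<Sum>n\<in>{0}. fps_const (-1) $ n * complex_of_real (f $ n))"
        by (rule sums_finite) auto
      moreover have "f $ 0 = 1" using f by (simp add: hausdorff_moment_def)
      ultimately show ?thesis by (simp add: L_def moment_functional_def sums_iff)
    qed
    then show ?thesis
      using id sK sKK f unfolding L_def
      by (metis (no_types, lifting) K_def abs_summable_fps_add abs_summable_fps_const abs_summable_fps_mult
          moment_functional_add moment_functional_cmult)
  qed
  moreover have "Re (L (geometric (cnj z))) = Re (L (geometric z))"
    using moment_functional_cnj[OF f, of "geometric z"] sK(1) by (simp add: L_def cnj_fps_geometric K_def)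
  ultimately have "A 0 - (norm z)\<^sup>2 * A 2 = 2 * Re (L (geometric z)) - 1"
    by (auto simp: A_def complex_eq_iff simp flip: of_real_power)
  moreover have "(norm z)\<^sup>2 * A 2 \<le> 1 * A 0"
    using A[of 0] A[of 1] A[of 2] power_le_one[of "norm z" 2] z
    by (intro mult_mono) (auto simp: eval_nat_numeral)
  ultimately show ?thesis by (simp add: L_def moment_functional_geometric)
qed

text \<open>
  With \<open>K(t) = 1 / ((1 - t z) (1 + t r))\<close> the difference of the kernels \<open>Re (1 / (1 - t z))\<close> and \<open>1 / (1 + t r)\<close>
  equals
  \<open>(r + Re z) t (1 - r\<^sup>2 t\<^sup>2) |K(t)|\<^sup>2 + (r\<^sup>2 - |z|\<^sup>2) (t\<^sup>2 + r t\<^sup>3) |K(t)|\<^sup>2\<close>, on which the functional is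
  nonnegative.
\<close>
lemma hausdorff_Re_ge_negative_axis:
  assumes f: "hausdorff_moment (fps_nth f)" and z: "norm z \<le> r" and r: "r < 1"
  shows "Re (eval_fps (complex_fps f) z) \<ge> Re (eval_fps (complex_fps f) (- of_real r))"
proof -
  define R where "R = - complex_of_real r"
  define K where "K = geometric z * geometric R"
  define L where "L = moment_functional (fps_nth f)"
  define A where "A s = Re (L (fps_X ^ s * (K * cnj_fps K)))" for s
  have r0: "0 \<le> r" using z norm_ge_zero order_trans by blast
  have sg: "abs_summable_fps (geometric z)" "abs_summable_fps (geometric (cnj z))" "abs_summable_fps (geometric R)"
    using z r r0 by (auto simp: R_def intro!: abs_summable_fps_geometric)
  have cR: "cnj R = R" by (simp add: R_def)
  have sK: "abs_summable_fps K" using sg by (simp add: K_def abs_summable_fps_mult)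
  have sKK: "abs_summable_fps (fps_X ^ s * (K * cnj_fps K))" for s
    using sg sK by (simp add: K_def cnj_fps_geometric cnj_fps_mult abs_summable_fps_mult abs_summable_fps_X_power cR)
  have A: "A (Suc s) \<le> A s" "0 \<le> A s" for s
    using moment_functional_square_mono[OF f sK(1)] by (simp_all only: A_def L_def)
  define p where "p = r + Re z"
  define d where "d = r\<^sup>2 - (norm z)\<^sup>2"
  have p0: "0 \<le> p" using z abs_Re_le_cmod[of z] by (simp add: p_def abs_le_iff)
  have d0: "0 \<le> d" using z by (simp add: d_def power_mono)
  have pz: "complex_of_real p = (z + cnj z) / 2 - R"
    by (simp add: p_def complex_add_cnj R_def)
  have dz: "complex_of_real d = R\<^sup>2 - z * cnj z"
    by (simp add: d_def R_def flip: complex_norm_square)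
  define S where "S s = fps_X ^ s * (K * cnj_fps K)" for s
  have id: "fps_const (of_real p) * S 1 + fps_const (- of_real (p * r\<^sup>2)) * S 3
      + fps_const (of_real d) * S 2 + fps_const (of_real (d * r)) * S 3
     = fps_const (1/2) * geometric z + fps_const (1/2) * geometric (cnj z) + fps_const (-1) * geometric R"
    (is "?l = ?r")
  proof -
    define g h k x Z W V where gdefs: "g = geometric z" "h = geometric (cnj z)" "k = geometric R"
      "x = (fps_X :: complex fps)" "Z = fps_const z" "W = fps_const (cnj z)" "V = fps_const R"
    have 1: "(1 - Z * x) * g = 1" and 2: "(1 - W * x) * h = 1" and 3: "(1 - V * x) * k = 1"
      by (simp_all add: gdefs geometric_inverse)
    have KK: "K * cnj_fps K = g * h * k * k"
      by (simp add: K_def cnj_fps_mult cnj_fps_geometric cR gdefs mult_ac)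
    have P2: "2 * fps_const (of_real p) = Z + W - 2 * V" unfolding pz gdefs
      by (simp add: fps_eq_iff numeral_fps_const)
    have D: "fps_const (of_real d) = V * V - Z * W" unfolding dz gdefs
      by (simp add: power2_eq_square)
    have rV: "complex_of_real r = - R" by (simp add: R_def)
    have 4: "fps_const (- of_real (p * r\<^sup>2)) = - (fps_const (of_real p) * V * V)"
      "fps_const (of_real (d * r)) = - (fps_const (of_real d) * V)"
      by (simp_all add: rV gdefs power2_eq_square mult_ac)
    have "2 * ?l = (2 * fps_const (of_real p)) * (x * (g * h * k * k)) - (2 * fps_const (of_real p)) * V * V * (x^3 * (g * h * k * k))
      + 2 * fps_const (of_real d) * (x^2 * (g * h * k * k)) - 2 * fps_const (of_real d) * V * (x^3 * (g * h * k * k))"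
      unfolding 4 S_def KK gdefs(4) power_one_right by algebra
    also have "\<dots> = g + h - 2 * k" unfolding P2 D using 1 2 3 by algebra
    also have "\<dots> = 2 * ?r" by (simp add: fps_eq_iff gdefs numeral_fps_const)
    finally have "2 * ?l = 2 * ?r" .
    moreover have "(2 :: complex fps) \<noteq> 0" by simp
    ultimately show ?thesis by (rule mult_left_cancel[THEN iffD1, rotated])
  qed
  have lin: "L (fps_const (of_real p) * S 1 + fps_const (- of_real (p * r\<^sup>2)) * S 3
      + fps_const (of_real d) * S 2 + fps_const (of_real (d * r)) * S 3)
      = of_real p * L (S 1) + (- of_real (p * r\<^sup>2)) * L (S 3) + of_real d * L (S 2) + of_real (d * r) * L (S 3)"
    using f sKK by (simp only: L_def S_def moment_functional_add moment_functional_cmult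
        abs_summable_fps_add abs_summable_fps_mult abs_summable_fps_const)
  have lin': "L (fps_const (1/2) * geometric z + fps_const (1/2) * geometric (cnj z) + fps_const (-1) * geometric R)
     = (1/2) * L (geometric z) + (1/2) * L (geometric (cnj z)) + (-1) * L (geometric R)"
    using f sg by (simp only: L_def S_def moment_functional_add moment_functional_cmult
        abs_summable_fps_add abs_summable_fps_mult abs_summable_fps_const)
  have "Re (L (geometric (cnj z))) = Re (L (geometric z))"
    using moment_functional_cnj[OF f, of "geometric z"] sg(1) by (simp add: L_def cnj_fps_geometric)
  then have "Re (L (geometric z)) - Re (L (geometric R)) = p * (A 1 - r\<^sup>2 * A 3) + d * A 2 + d * r * A 3"
    using arg_cong[OF id, of L] unfolding lin lin' by (simp add: A_def S_def complex_eq_iff algebra_simps)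
  moreover have "r\<^sup>2 * A 3 \<le> 1 * A 1"
    using A[of 1] A[of 2] A[of 3] power_le_one[of r 2] r r0
    by (intro mult_mono) (auto simp: eval_nat_numeral)
  then have "0 \<le> p * (A 1 - r\<^sup>2 * A 3) + d * A 2 + d * r * A 3"
    using p0 d0 r0 A by (intro add_nonneg_nonneg mult_nonneg_nonneg) auto
  ultimately show ?thesis by (simp add: L_def R_def moment_functional_geometric)
qed

section \<open>Values of real power series in the unit disc\<close>

lemma complex_fps_hom:
  "complex_fps (f * g) = complex_fps f * complex_fps g"
  "complex_fps (f + g) = complex_fps f + complex_fps g"
  "complex_fps (f - g) = complex_fps f - complex_fps g"
  "complex_fps (fps_deriv f) = fps_deriv (complex_fps f)"
  "complex_fps fps_X = fps_X"
  "complex_fps (fps_const k) = fps_const (of_real k)"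
  "complex_fps 1 = 1"
  by (rule fps_ext; simp add: fps_mult_nth)+

definition converges_on_disc :: "real fps \<Rightarrow> bool" where
  "converges_on_disc f \<longleftrightarrow> fps_conv_radius (complex_fps f) \<ge> 1"

definition eval_real :: "real fps \<Rightarrow> complex \<Rightarrow> complex" where
  "eval_real f = eval_fps (complex_fps f)"

lemma converges_on_discD:
  "converges_on_disc f \<Longrightarrow> norm z < 1 \<Longrightarrow> ereal (norm z) < fps_conv_radius (complex_fps f)"
  unfolding converges_on_disc_def by (rule less_le_trans[of _ 1]) (simp_all add: one_ereal_def)

lemma converges_on_discI:
  assumes "\<And>z :: complex. norm z < 1 \<Longrightarrow> summable (\<lambda>n. of_real (f $ n) * z ^ n)"
  shows "converges_on_disc f"
  unfolding converges_on_disc_def fps_conv_radius_def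
proof (rule conv_radius_geI_ex)
  fix r :: real assume "0 < r" "ereal r < 1"
  then have "norm (complex_of_real r) < 1" "norm (complex_of_real r) = r" by (auto simp: one_ereal_def)
  with assms show "\<exists>z. norm z = r \<and> summable (\<lambda>n. complex_fps f $ n * z ^ n)"
    by (intro exI[of _ "of_real r"]) auto
qed

lemma converges_on_disc_hausdorff:
  assumes "hausdorff_moment (fps_nth f)"
  shows "converges_on_disc f"
proof (rule converges_on_discI)
  fix z :: complex assume "norm z < 1"
  from moment_functional_summable[OF assms abs_summable_fps_geometric[OF this]]
  show "summable (\<lambda>n. of_real (f $ n) * z ^ n)" by (simp add: geometric_def mult.commute)
qed

lemma converges_on_disc_mult:
  "converges_on_disc f \<Longrightarrow> converges_on_disc g \<Longrightarrow> converges_on_disc (f * g)"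
  unfolding converges_on_disc_def complex_fps_hom
  by (rule order_trans[OF _ fps_conv_radius_mult]) simp

lemma converges_on_disc_add:
  "converges_on_disc f \<Longrightarrow> converges_on_disc g \<Longrightarrow> converges_on_disc (f + g)"
  unfolding converges_on_disc_def complex_fps_hom
  by (rule order_trans[OF _ fps_conv_radius_add]) simp

lemma converges_on_disc_diff:
  "converges_on_disc f \<Longrightarrow> converges_on_disc g \<Longrightarrow> converges_on_disc (f - g)"
  unfolding converges_on_disc_def complex_fps_hom
  by (rule order_trans[OF _ fps_conv_radius_diff]) simp

lemma converges_on_disc_deriv: "converges_on_disc f \<Longrightarrow> converges_on_disc (fps_deriv f)"
  unfolding converges_on_disc_def complex_fps_hom
  using fps_conv_radius_deriv order_trans by blast

lemma converges_on_disc_basic: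
  "converges_on_disc fps_X" "converges_on_disc (fps_const k)" "converges_on_disc 1"
  by (simp_all add: converges_on_disc_def complex_fps_hom)

lemmas converges_on_disc_intros =
  converges_on_disc_mult converges_on_disc_add converges_on_disc_diff converges_on_disc_deriv
  converges_on_disc_basic

lemma eval_real_mult:
  "converges_on_disc f \<Longrightarrow> converges_on_disc g \<Longrightarrow> norm z < 1 \<Longrightarrow> eval_real (f * g) z = eval_real f z * eval_real g z"
  by (simp add: eval_real_def complex_fps_hom eval_fps_mult converges_on_discD)

lemma eval_real_add:
  "converges_on_disc f \<Longrightarrow> converges_on_disc g \<Longrightarrow> norm z < 1 \<Longrightarrow> eval_real (f + g) z = eval_real f z + eval_real g z"
  by (simp add: eval_real_def complex_fps_hom eval_fps_add converges_on_discD)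

lemma eval_real_diff:
  "converges_on_disc f \<Longrightarrow> converges_on_disc g \<Longrightarrow> norm z < 1 \<Longrightarrow> eval_real (f - g) z = eval_real f z - eval_real g z"
  by (simp add: eval_real_def complex_fps_hom eval_fps_diff converges_on_discD)

lemma eval_real_basic: "eval_real fps_X z = z" "eval_real (fps_const k) z = of_real k" "eval_real 1 z = 1"
  by (simp_all add: eval_real_def complex_fps_hom)

lemmas eval_real_simps = eval_real_mult eval_real_add eval_real_diff eval_real_basic converges_on_disc_intros

lemma eval_real_at_0: "eval_real f 0 = of_real (f $ 0)"
  by (simp add: eval_real_def eval_fps_at_0)

lemma eval_real_sums:
  "converges_on_disc f \<Longrightarrow> norm z < 1 \<Longrightarrow> (\<lambda>n. of_real (f $ n) * z ^ n) sums eval_real f z"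
  using sums_eval_fps[of z "complex_fps f"] converges_on_discD[of f z] by (simp add: eval_real_def)

lemma eval_real_has_field_derivative:
  "converges_on_disc f \<Longrightarrow> norm z < 1 \<Longrightarrow> (eval_real f has_field_derivative eval_real (fps_deriv f) z) (at z)"
  unfolding eval_real_def complex_fps_hom by (rule has_field_derivative_eval_fps) (rule converges_on_discD)

lemma eval_real_of_real_in_Reals:
  assumes "converges_on_disc f" "\<bar>x\<bar> < 1"
  shows "eval_real f (of_real x) \<in> \<real>"
proof -
  have "(\<lambda>n. of_real (f $ n) * of_real x ^ n) sums eval_real f (of_real x)"
    using assms by (intro eval_real_sums) auto
  then have "(\<lambda>n. Im (of_real (f $ n) * of_real x ^ n)) sums Im (eval_real f (of_real x))"
    by (rule sums_Im)
  then have "(\<lambda>n::nat. 0) sums Im (eval_real f (of_real x))" by (simp flip: of_real_power of_real_mult)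
  then show ?thesis using sums_unique2 sums_zero by (auto simp: complex_is_Real_iff)
qed

lemma eval_real_hyp: "eval_real (gauss_fps a b c) z = hyp2F1_series a b c z"
  by (simp add: hyp2F1_series_eq eval_real_def eval_fps_def gauss_fps_def)

section \<open>The derivative of z F(1,b;c;z) and its order of convexity\<close>

text \<open>
  The formal quotient \<open>f\<close> is bounded by \<open>1\<close> coefficientwise, so the factorization of \<open>F(a+1,b;c)\<close> also
  holds between analytic functions on the disc.
\<close>
lemma gauss_fps_step:
  assumes "0 \<le> a" "a \<le> c" "0 < b" "b \<le> c" "converges_on_disc (gauss_fps a b c)"
  obtains f where "hausdorff_moment (fps_nth f)" "converges_on_disc (gauss_fps (a + 1) b c)"
    "\<And>z. norm z < 1 \<Longrightarrow> eval_real (gauss_fps (a + 1) b c) z = eval_real f z * eval_real (gauss_fps a b c) z"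
proof -
  obtain f where f: "hausdorff_moment (fps_nth f)" "gauss_fps (a + 1) b c = f * gauss_fps a b c"
    using gauss_fps_ratio_hausdorff[OF assms(1-4)] by blast
  show thesis
  proof (rule that[OF f(1)])
    show "converges_on_disc (gauss_fps (a + 1) b c)"
      unfolding f(2) by (intro converges_on_disc_mult converges_on_disc_hausdorff f assms)
    show "eval_real (gauss_fps (a + 1) b c) z = eval_real f z * eval_real (gauss_fps a b c) z" if "norm z < 1" for z
      unfolding f(2) using that by (intro eval_real_mult converges_on_disc_hausdorff f assms)
  qed
qed

lemma eval_real_hausdorff_Re_ge_half:
  "hausdorff_moment (fps_nth f) \<Longrightarrow> norm z < 1 \<Longrightarrow> Re (eval_real f z) \<ge> 1 / 2"
  unfolding eval_real_def by (rule hausdorff_Re_ge_half)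

text \<open>
  Starting from \<open>F(0,b;c) = 1\<close>, the function \<open>F(2,b;c)\<close> is a product of two Hausdorff moment series. Both
  have real part at least \<open>1/2\<close>, so the product has no zeros and stays away from zero near \<open>-1\<close>.
\<close>
lemma gauss_fps_first_steps:
  assumes "0 < b" "b \<le> c" "1 \<le> c"
  shows gauss_fps1_converges: "converges_on_disc (gauss_fps 1 b c)"
    and gauss_fps2_converges: "converges_on_disc (gauss_fps 2 b c)"
    and gauss_fps2_nonzero: "norm z < 1 \<Longrightarrow> eval_real (gauss_fps 2 b c) z \<noteq> 0"
    and gauss_fps2_norm_ge: "0 \<le> r \<Longrightarrow> r < 1 \<Longrightarrow> norm (eval_real (gauss_fps 2 b c) (- of_real r)) \<ge> 1 / 4"
proof -
  have "converges_on_disc (gauss_fps 0 b c)" by (simp add: converges_on_disc_basic)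
  with assms obtain f where f: "hausdorff_moment (fps_nth f)" "converges_on_disc (gauss_fps 1 b c)"
    "\<And>z. norm z < 1 \<Longrightarrow> eval_real (gauss_fps 1 b c) z = eval_real f z"
    using gauss_fps_step[of 0 c b] by (auto simp: eval_real_basic)
  then obtain h where h: "hausdorff_moment (fps_nth h)" "converges_on_disc (gauss_fps 2 b c)"
    "\<And>z. norm z < 1 \<Longrightarrow> eval_real (gauss_fps 2 b c) z = eval_real h z * eval_real (gauss_fps 1 b c) z"
    using assms gauss_fps_step[of 1 c b] by auto
  show "converges_on_disc (gauss_fps 1 b c)" "converges_on_disc (gauss_fps 2 b c)" by fact+
  have ge: "norm (eval_real (gauss_fps 2 b c) z) \<ge> 1 / 4" if z: "norm z < 1" for z
  proof -
    have "norm (eval_real h z) \<ge> 1 / 2" "norm (eval_real f z) \<ge> 1 / 2"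
      using eval_real_hausdorff_Re_ge_half[OF h(1) z] eval_real_hausdorff_Re_ge_half[OF f(1) z]
        complex_Re_le_cmod order_trans by blast+
    then have "(1 / 2) * (1 / 2) \<le> norm (eval_real h z) * norm (eval_real f z)" by (intro mult_mono) auto
    then show ?thesis using z by (simp add: h f norm_mult)
  qed
  show "norm z < 1 \<Longrightarrow> eval_real (gauss_fps 2 b c) z \<noteq> 0" using ge[of z] by auto
  show "0 \<le> r \<Longrightarrow> r < 1 \<Longrightarrow> norm (eval_real (gauss_fps 2 b c) (- of_real r)) \<ge> 1 / 4" using ge by simp
qed

lemma order_of_convexity_eq_INF:
  assumes "0 < b" "b \<le> c" "1 \<le> c"
  shows "order_of_convexity (\<lambda>z. z * hyp2F1 1 b c z) =
    Some (1 + (INF z\<in>ball 0 1. ereal (Re (z * eval_real (fps_deriv (gauss_fps 2 b c)) z / eval_real (gauss_fps 2 b c) z))))"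
proof -
  define f where "f = (\<lambda>z. z * hyp2F1 1 b c z)"
  note c1 = gauss_fps1_converges[OF assms] and c2 = gauss_fps2_converges[OF assms]
  have fz: "f z = z * eval_real (gauss_fps 1 b c) z" if "z \<in> ball 0 1" for z
    using that by (simp add: f_def hyp2F1_def eval_real_hyp)
  have der: "(f has_field_derivative eval_real (gauss_fps 2 b c) z) (at z)" if z: "z \<in> ball 0 1" for z
  proof -
    have "((\<lambda>z. z * eval_real (gauss_fps 1 b c) z) has_field_derivative
        z * eval_real (fps_deriv (gauss_fps 1 b c)) z + eval_real (gauss_fps 1 b c) z) (at z)"
      using z by (auto intro!: derivative_eq_intros eval_real_has_field_derivative c1)
    moreover have "z * eval_real (fps_deriv (gauss_fps 1 b c)) z + eval_real (gauss_fps 1 b c) z = eval_real (gauss_fps 2 b c) z"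
    proof -
      have "fps_X * fps_deriv (gauss_fps 1 b c) + gauss_fps 1 b c = gauss_fps 2 b c"
        using gauss_fps_euler_operator[of 1 b c] by simp
      then have "eval_real (fps_X * fps_deriv (gauss_fps 1 b c) + gauss_fps 1 b c) z = eval_real (gauss_fps 2 b c) z" by simp
      then show ?thesis using z c1 by (simp add: eval_real_simps)
    qed
    ultimately have "((\<lambda>z. z * eval_real (gauss_fps 1 b c) z) has_field_derivative eval_real (gauss_fps 2 b c) z) (at z)" by simp
    then show ?thesis
      by (rule has_field_derivative_transform_within_open[of _ _ _ "ball 0 1"]) (use z fz in auto)
  qed
  have d1: "deriv f z = eval_real (gauss_fps 2 b c) z" if "z \<in> ball 0 1" for z
    using der[OF that] by (rule DERIV_imp_deriv)
  have d2: "deriv (deriv f) z = eval_real (fps_deriv (gauss_fps 2 b c)) z" if z: "z \<in> ball 0 1" for z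
  proof -
    have "eventually (\<lambda>w. w \<in> ball 0 1) (nhds z)" using z by (intro eventually_nhds_in_open) auto
    then have "eventually (\<lambda>w. deriv f w = eval_real (gauss_fps 2 b c) w) (nhds z)"
      by eventually_elim (rule d1)
    then have "deriv (deriv f) z = deriv (eval_real (gauss_fps 2 b c)) z" by (rule deriv_cong_ev) simp
    also have "\<dots> = eval_real (fps_deriv (gauss_fps 2 b c)) z"
      using z by (intro DERIV_imp_deriv eval_real_has_field_derivative c2) auto
    finally show ?thesis .
  qed
  have an: "f analytic_on ball 0 1"
  proof -
    have "f holomorphic_on ball 0 1"
      using der by (subst holomorphic_on_open) blast+
    then show ?thesis by (simp add: analytic_on_open)
  qed
  have norm: "f 0 = 0" "deriv f 0 = 1" by (simp_all add: f_def[THEN fun_cong, of 0] d1 eval_real_at_0)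
  have "(INF z\<in>ball 0 1. ereal (Re (z * deriv (deriv f) z / deriv f z)))
      = (INF z\<in>ball 0 1. ereal (Re (z * eval_real (fps_deriv (gauss_fps 2 b c)) z / eval_real (gauss_fps 2 b c) z)))"
    by (rule INF_cong[OF refl]) (simp add: d1 d2)
  then show ?thesis
    unfolding f_def[symmetric] order_of_convexity_def
    using an norm gauss_fps2_nonzero[OF assms] by (simp add: d1)
qed

lemma INF_ereal_eqI:
  fixes u :: "'a \<Rightarrow> real"
  assumes "\<And>z. z \<in> B \<Longrightarrow> k \<le> u z" and "\<And>e. e > 0 \<Longrightarrow> \<exists>z\<in>B. u z < k + e"
  shows "(INF z\<in>B. ereal (u z)) = ereal k"
proof (rule antisym)
  show "(INF z\<in>B. ereal (u z)) \<le> ereal k"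
  proof (rule ereal_le_epsilon2)
    fix e :: real assume "e > 0"
    then obtain z where "z \<in> B" "u z < k + e" using assms(2) by blast
    then show "(INF z\<in>B. ereal (u z)) \<le> ereal k + ereal e"
      by (intro INF_lower2[of z]) auto
  qed
qed (use assms(1) in \<open>auto intro!: INF_greatest\<close>)

section \<open>Analytic continuation to the cut plane\<close>

lemma open_cut_plane: "open cut_plane"
proof -
  have "complex_of_real ` {1..} = {z. Im z = 0 \<and> 1 \<le> Re z}"
  proof (intro equalityI subsetI)
    fix z assume "z \<in> {z. Im z = 0 \<and> 1 \<le> Re z}"
    then have "z = of_real (Re z)" "Re z \<in> {1..}" by (simp_all add: complex_eq_iff)
    then show "z \<in> complex_of_real ` {1..}" by blast
  qed auto
  moreover have "closed {z. Im z = 0 \<and> 1 \<le> Re z}"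
    by (intro closed_Collect_conj closed_Collect_eq closed_Collect_le continuous_intros)
  ultimately have "closed (complex_of_real ` {1..})" by simp
  then show ?thesis unfolding cut_plane_def by (rule open_Compl)
qed

text \<open>
  The cut plane is starlike about the origin and \<open>w \<mapsto> 1 - w\<close> maps it onto the complement of the
  nonpositive reals, where the principal powers are holomorphic.
\<close>
lemma cut_plane_not_nonpos:
  assumes "z \<in> cut_plane" "0 \<le> s" "s \<le> 1"
  shows "1 - z * of_real s \<notin> \<real>\<^sub>\<le>\<^sub>0"
proof
  assume "1 - z * of_real s \<in> \<real>\<^sub>\<le>\<^sub>0"
  then obtain x where x: "1 - z * of_real s = of_real x" "x \<le> 0" by (elim nonpos_Reals_cases)
  then have s: "s > 0" using assms(2) by (cases "s = 0") auto
  have "z * of_real s = of_real (1 - x)" using x by (simp add: algebra_simps)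
  then have "z = of_real ((1 - x) / s)" using s by (simp add: field_simps)
  moreover have "(1 - x) / s \<ge> 1" using s assms(3) x(2) by (simp add: field_simps)
  ultimately have "z \<in> complex_of_real ` {1..}" by blast
  then show False using assms(1) by (simp add: cut_plane_def)
qed

lemma cut_plane_connected: "connected cut_plane"
proof (rule starlike_imp_connected)
  show "starlike cut_plane" unfolding starlike_def
  proof (intro bexI[of _ 0] ballI subsetI)
    show "0 \<in> cut_plane" by (auto simp: cut_plane_def)
    fix z w assume z: "z \<in> cut_plane" and "w \<in> closed_segment 0 z"
    then obtain s where s: "0 \<le> s" "s \<le> 1" "w = z * of_real s"
      by (auto simp: closed_segment_def scaleR_conv_of_real mult.commute)
    then have "1 - w \<notin> \<real>\<^sub>\<le>\<^sub>0" using cut_plane_not_nonpos[OF z] by simp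
    moreover have "1 - complex_of_real x \<in> \<real>\<^sub>\<le>\<^sub>0" if "1 \<le> x" for x
      using that nonpos_Reals_of_real_iff[of "1 - x", where 'a = complex] by simp
    ultimately show "w \<in> cut_plane" by (auto simp: cut_plane_def)
  qed
qed

lemma ball_subset_cut_plane: "ball 0 1 \<subseteq> cut_plane"
  by (auto simp: cut_plane_def)

text \<open>
  The cut plane is connected, so by the identity theorem any holomorphic extension gives the value that the
  definite description picks.
\<close>
lemma hyp2F1_extension:
  assumes g: "g holomorphic_on cut_plane" "\<And>u. norm u < 1 \<Longrightarrow> g u = eval_real (gauss_fps a b c) u"
    and z: "z \<in> cut_plane"
  shows "hyp2F1 a b c z = g z"
proof (cases "z \<in> ball 0 1")
  case True
  then show ?thesis using g(2)[of z] by (simp add: hyp2F1_def eval_real_hyp)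
next
  case False
  have "h z = g z" if h: "h holomorphic_on cut_plane" "\<forall>u\<in>ball 0 1. h u = hyp2F1_series a b c u" for h
  proof (rule analytic_continuation_open[of "ball 0 1" cut_plane h g z])
    show "ball (0 :: complex) 1 \<noteq> {}" by simp
    show "h w = g w" if "w \<in> ball 0 1" for w using that h g by (simp add: eval_real_hyp)
  qed (use open_cut_plane cut_plane_connected ball_subset_cut_plane h g z in auto)
  moreover have "\<forall>u\<in>ball 0 1. g u = hyp2F1_series a b c u" using g(2) by (simp add: eval_real_hyp)
  ultimately have "(THE w. \<exists>g. g holomorphic_on cut_plane
                     \<and> (\<forall>u\<in>ball 0 1. g u = hyp2F1_series a b c u) \<and> w = g z) = g z"
    using g(1) by (intro the_equality exI[of _ g] conjI refl) blast+
  then show ?thesis using False by (simp add: hyp2F1_def)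
qed

lemma one_minus_power_sums:
  assumes "norm (z::complex) < 1"
  shows "(\<lambda>n. of_real (one_minus_power s $ n) * z ^ n) sums ((1 - z) powr of_real s)"
proof -
  have "(\<lambda>n. (of_real s gchoose n) * (-z) ^ n) sums (1 + (-z)) powr of_real s"
    using assms by (intro gen_binomial_complex) simp
  moreover have "(of_real s gchoose n) * (-z) ^ n = of_real (one_minus_power s $ n) * z ^ n" for n
  proof -
    have "(-1 :: complex) ^ n * (-1) ^ n = 1" by (simp flip: power_mult_distrib)
    moreover have "(of_real s gchoose n) = (-1) ^ n * complex_of_real (one_minus_power s $ n)"
      by (simp add: one_minus_power_def gbinomial_pochhammer flip: pochhammer_of_real)
    moreover have "(-z) ^ n = (-1) ^ n * z ^ n" by (rule power_minus)
    ultimately show ?thesis by (metis mult.assoc mult.left_commute mult_1)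
  qed
  ultimately show ?thesis by simp
qed

lemma one_minus_power_converges: "converges_on_disc (one_minus_power s)"
  by (rule converges_on_discI) (rule sums_summable, rule one_minus_power_sums)

lemma eval_real_binom: "norm z < 1 \<Longrightarrow> eval_real (one_minus_power s) z = (1 - z) powr of_real s"
  using sums_unique2[OF eval_real_sums[OF one_minus_power_converges] one_minus_power_sums] by blast

text \<open>
  Termwise integration of the binomial series, uniformly convergent in \<open>t\<close> for fixed \<open>z\<close>.
\<close>
lemma one_minus_power_integral_sums:
  fixes z :: complex and \<psi> :: "real \<Rightarrow> real"
  assumes z: "norm z < 1" and \<psi>: "continuous_on {0..1} \<psi>"
  shows "(\<lambda>n. of_real (one_minus_power s $ n * integral {0..1} (\<lambda>t. \<psi> t * t ^ n)) * z ^ n) sums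
     integral {0..1} (\<lambda>t. of_real (\<psi> t) * (1 - z * of_real t) powr of_real s)"
proof -
  define T where "T n t = complex_of_real (\<psi> t) * (of_real (one_minus_power s $ n) * (z * of_real t) ^ n)" for n t
  have bd: "\<exists>C\<ge>0. \<forall>t\<in>{0..1}. \<bar>\<psi> t\<bar> \<le> C"
  proof -
    have "compact (\<psi> ` {0..1})" using \<psi> by (rule compact_continuous_image) simp
    then obtain C where "\<forall>x\<in>\<psi> ` {0..1}. norm x \<le> C" using compact_imp_bounded bounded_iff by metis
    then have "\<forall>t\<in>{0..1}. \<bar>\<psi> t\<bar> \<le> max C 0" by (simp add: le_max_iff_disj)
    then show ?thesis by (intro exI[of _ "max C 0"]) simp
  qed
  then obtain C where C: "C \<ge> 0" "\<And>t. t \<in> {0..1} \<Longrightarrow> \<bar>\<psi> t\<bar> \<le> C" by blast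
  have "summable (\<lambda>n. norm (complex_fps (one_minus_power s) $ n * z ^ n))"
    using norm_summable_fps[of z "complex_fps (one_minus_power s)"] converges_on_discD[OF one_minus_power_converges z] by blast
  then have M: "summable (\<lambda>n. C * (\<bar>one_minus_power s $ n\<bar> * norm z ^ n))"
    by (intro summable_mult) (simp add: norm_mult norm_power)
  have u: "uniform_limit {0..1} (\<lambda>N t. \<Sum>n<N. T n t) (\<lambda>t. \<Sum>n. T n t) sequentially"
  proof (rule Weierstrass_m_test[OF _ M])
    fix n and t :: real assume t: "t \<in> {0..1}"
    then have "\<bar>t ^ n\<bar> \<le> 1" by (simp add: power_le_one)
    then have "norm z ^ n * \<bar>t ^ n\<bar> \<le> norm z ^ n" by (intro mult_left_le) auto
    then show "norm (T n t) \<le> C * (\<bar>one_minus_power s $ n\<bar> * norm z ^ n)"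
      using C(2)[OF t] C(1) t by (auto simp: T_def norm_mult norm_power power_mult_distrib intro!: mult_mono)
  qed
  have lim: "(\<Sum>n. T n t) = of_real (\<psi> t) * (1 - z * of_real t) powr of_real s" if t: "t \<in> {0..1}" for t
  proof -
    have "norm (z * of_real t) \<le> norm z * 1" unfolding norm_mult using t by (intro mult_left_mono) auto
    then have "norm (z * of_real t) < 1" using z by simp
    from sums_mult[OF one_minus_power_sums[OF this], of "of_real (\<psi> t)" s] show ?thesis
      by (simp add: T_def sums_iff)
  qed
  have cT: "continuous_on {0..1} (T n)" for n
    unfolding T_def by (intro continuous_intros \<psi>)
  obtain I J where I: "\<And>N. ((\<lambda>t. \<Sum>n<N. T n t) has_integral I N) {0..1}"
    and J: "((\<lambda>t. \<Sum>n. T n t) has_integral J) {0..1}" and IJ: "I \<longlonglongrightarrow> J"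
  proof -
    have "continuous_on {0..1} (\<lambda>t. \<Sum>n<N. T n t)" for N
      using cT by (intro continuous_on_sum) auto
    from uniform_limit_integral[OF u this sequentially_bot] show thesis using that by blast
  qed
  have "J = integral {0..1} (\<lambda>t. \<Sum>n. T n t)" using J by (simp add: integral_unique)
  also have "\<dots> = integral {0..1} (\<lambda>t. of_real (\<psi> t) * (1 - z * of_real t) powr of_real s)"
    by (rule integral_cong) (rule lim)
  finally have J': "J = integral {0..1} (\<lambda>t. of_real (\<psi> t) * (1 - z * of_real t) powr of_real s)" .
  have "integral {0..1} (T n) = of_real (one_minus_power s $ n * integral {0..1} (\<lambda>t. \<psi> t * t ^ n)) * z ^ n" for n
  proof -
    have "T n = (\<lambda>t. of_real (\<psi> t * t ^ n) * (of_real (one_minus_power s $ n) * z ^ n))"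
      by (auto simp: T_def power_mult_distrib)
    moreover have "((\<lambda>t. \<psi> t * t ^ n) has_integral integral {0..1} (\<lambda>t. \<psi> t * t ^ n)) {0..1}"
      using \<psi> by (intro integrable_integral integrable_continuous_real continuous_intros)
    then have "((\<lambda>t. complex_of_real (\<psi> t * t ^ n) * (of_real (one_minus_power s $ n) * z ^ n)) has_integral
        of_real (integral {0..1} (\<lambda>t. \<psi> t * t ^ n)) * (of_real (one_minus_power s $ n) * z ^ n)) {0..1}"
      by (intro has_integral_mult_left has_integral_of_real)
    ultimately have "(T n has_integral
        of_real (integral {0..1} (\<lambda>t. \<psi> t * t ^ n)) * (of_real (one_minus_power s $ n) * z ^ n)) {0..1}"
      by (simp only:)
    then show ?thesis by (simp add: integral_unique mult_ac)
  qed
  moreover have "I = (\<lambda>N. \<Sum>n<N. integral {0..1} (T n))"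
  proof (rule ext)
    fix N show "I N = (\<Sum>n<N. integral {0..1} (T n))"
    using integral_unique[OF I[of N]] cT by (subst (asm) integral_sum) (auto intro!: integrable_continuous_real)
  qed
  ultimately show ?thesis using IJ unfolding sums_def J' by (simp only:)
qed

lemma continuous_on_slit_powr:
  fixes f :: "'a::topological_space \<Rightarrow> complex"
  assumes "continuous_on A f" "\<And>x. x \<in> A \<Longrightarrow> f x \<notin> \<real>\<^sub>\<le>\<^sub>0"
  shows "continuous_on A (\<lambda>x. f x powr w)"
proof -
  have "continuous_on A (\<lambda>x. exp (w * Ln (f x)))"
    using assms by (intro continuous_intros continuous_on_Ln) auto
  moreover have "f x \<noteq> 0" if "x \<in> A" for x using assms(2)[OF that] by auto
  ultimately show ?thesis by (simp add: powr_def cong: continuous_on_cong)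
qed

lemma powr_integral_holomorphic:
  fixes \<psi> :: "real \<Rightarrow> real"
  assumes \<psi>: "continuous_on {0..1} \<psi>"
  shows "(\<lambda>z. integral {0..1} (\<lambda>t. of_real (\<psi> t) * (1 - z * of_real t) powr of_real s)) holomorphic_on cut_plane"
proof -
  have "\<exists>e>0. ball z0 e \<subseteq> cut_plane" if "z0 \<in> cut_plane" for z0
    using that open_cut_plane openE by blast
  moreover have "(\<lambda>z. integral (cbox 0 1) (\<lambda>t. of_real (\<psi> t) * (1 - z * of_real t) powr of_real s)) holomorphic_on ball z0 e"
    if sub: "ball z0 e \<subseteq> cut_plane" for z0 e
  proof (rule leibniz_rule_holomorphic[where fx = "\<lambda>z t. of_real (\<psi> t) * (of_real s * (1 - z * of_real t) powr (of_real s - 1) * (- of_real t))"])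
    fix z t assume z: "z \<in> ball z0 e" and t: "t \<in> cbox (0::real) 1"
    have "1 - z * of_real t \<notin> \<real>\<^sub>\<le>\<^sub>0" using sub z t by (intro cut_plane_not_nonpos) auto
    then show "((\<lambda>z. of_real (\<psi> t) * (1 - z * of_real t) powr of_real s) has_field_derivative
       of_real (\<psi> t) * (of_real s * (1 - z * of_real t) powr (of_real s - 1) * (- of_real t))) (at z within ball z0 e)"
      by (auto intro!: derivative_eq_intros)
  next
    fix z assume z: "z \<in> ball z0 e"
    have "1 - z * of_real t \<notin> \<real>\<^sub>\<le>\<^sub>0" if "t \<in> cbox 0 1" for t using sub z that by (intro cut_plane_not_nonpos) auto
    then have "continuous_on (cbox 0 1) (\<lambda>t. of_real (\<psi> t) * (1 - z * of_real t) powr of_real s)"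
      using \<psi> by (intro continuous_on_mult continuous_on_of_real continuous_on_slit_powr continuous_intros) auto
    then show "(\<lambda>t. of_real (\<psi> t) * (1 - z * of_real t) powr of_real s) integrable_on cbox 0 1"
      by (rule integrable_continuous)
  next
    have nz: "1 - z * of_real t \<notin> \<real>\<^sub>\<le>\<^sub>0" if "z \<in> ball z0 e" "t \<in> {0..1}" for z t
      using sub that by (intro cut_plane_not_nonpos) auto
    have c: "continuous_on (ball z0 e \<times> {0..1}) (\<lambda>p. \<psi> (snd p))"
      by (rule continuous_on_compose2[OF \<psi>]) (auto intro!: continuous_intros)
    have "continuous_on (ball z0 e \<times> {0..1}) (\<lambda>p. of_real (\<psi> (snd p)) * (of_real s * (1 - fst p * of_real (snd p)) powr (of_real s - 1) * (- of_real (snd p))))"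
      using nz c by (intro continuous_on_mult continuous_on_of_real continuous_on_slit_powr continuous_intros) auto
    then show "continuous_on (ball z0 e \<times> cbox 0 1) (\<lambda>(z, t). of_real (\<psi> t) * (of_real s * (1 - z * of_real t) powr (of_real s - 1) * (- of_real t)))"
      by (simp add: case_prod_beta)
  qed simp
  ultimately have "(\<lambda>z. integral {0..1} (\<lambda>t. of_real (\<psi> t) * (1 - z * of_real t) powr of_real s)) analytic_on cut_plane"
    unfolding analytic_on_def cbox_interval by meson
  then show ?thesis by (rule analytic_imp_holomorphic)
qed

text \<open>
  By Euler's transformation \<open>F(1,b;c;z) = (1 - z)\<^bsup>c-1-b\<^esup> F(c-1, c-b; c; z)\<close>, and the second factor is
  \<open>(c - 1) \<integral>\<^sub>0\<^sup>1 t\<^bsup>c-2\<^esup> (1 - t z)\<^bsup>b-c\<^esup> dt\<close>. The assumption \<open>c > 2\<close> makes the weight continuous at \<open>0\<close>, where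
  the function \<open>powr\<close> has the value \<open>0\<close>.
\<close>
lemma gauss_fps1_extension:
  assumes "2 < c"
  shows "\<exists>g. g holomorphic_on cut_plane \<and> (\<forall>u. norm u < 1 \<longrightarrow> g u = eval_real (gauss_fps 1 b c) u)"
proof -
  define \<psi> where "\<psi> t = t powr (c - 2)" for t :: real
  define I :: "complex \<Rightarrow> complex" where "I z = integral {0..1} (\<lambda>t. of_real (\<psi> t) * (1 - z * of_real t) powr of_real (b - c))" for z
  define g where "g z = of_real (c - 1) * (1 - z) powr of_real (c - 1 - b) * I z" for z
  have \<psi>: "continuous_on {0..1} \<psi>"
    unfolding \<psi>_def using assms by (intro continuous_on_powr' continuous_intros) auto
  have Ih: "I holomorphic_on cut_plane" unfolding I_def by (rule powr_integral_holomorphic[OF \<psi>])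
  have gh: "g holomorphic_on cut_plane" unfolding g_def
    using cut_plane_not_nonpos[of _ 1] by (intro holomorphic_intros Ih) auto
  have mom: "integral {0..1} (\<lambda>t. \<psi> t * t ^ n) = 1 / (c - 1 + real n)" for n
  proof -
    have "((\<lambda>t. t powr (c - 2 + real n)) has_integral 1 powr (c - 2 + real n + 1) / (c - 2 + real n + 1)) {0..1}"
      using assms by (intro has_integral_powr_from_0) auto
    moreover have "\<psi> t * t ^ n = t powr (c - 2 + real n)" if "t \<in> {0..1}" for t
      using that assms by (cases "t = 0") (auto simp: \<psi>_def powr_add powr_realpow)
    ultimately have "((\<lambda>t. \<psi> t * t ^ n) has_integral 1 / (c - 1 + real n)) {0..1}"
      by (subst has_integral_cong[where g = "\<lambda>t. t powr (c - 2 + real n)"]) (auto simp: algebra_simps)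
    then show ?thesis by (rule integral_unique)
  qed
  define H where "H = gauss_fps (c - 1) (c - b) c"
  have H: "(c - 1) * (one_minus_power (b - c) $ n * integral {0..1} (\<lambda>t. \<psi> t * t ^ n)) = H $ n" for n
  proof -
    have "pochhammer c n > 0" using assms by (intro pochhammer_pos) auto
    moreover have "(c - 1) * pochhammer c n = pochhammer (c - 1) n * (c - 1 + real n)"
      using pochhammer_rec[of "c - 1" n] pochhammer_Suc[of "c - 1" n] by simp
    ultimately show ?thesis using assms unfolding mom
      by (simp add: H_def gauss_fps_def one_minus_power_def divide_simps) 
  qed
  have HI: "(\<lambda>n. of_real (H $ n) * z ^ n) sums (of_real (c - 1) * I z)" if "norm z < 1" for z
  proof -
    have "(\<lambda>n. of_real (c - 1) * (of_real (one_minus_power (b - c) $ n * integral {0..1} (\<lambda>t. \<psi> t * t ^ n)) * z ^ n))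
      sums (of_real (c - 1) * I z)"
      unfolding I_def by (intro sums_mult one_minus_power_integral_sums that \<psi>)
    moreover have "of_real (c - 1) * (of_real (one_minus_power (b - c) $ n * integral {0..1} (\<lambda>t. \<psi> t * t ^ n)) * z ^ n)
      = of_real (H $ n) * z ^ n" for n
      unfolding H[symmetric] by (simp add: mult.assoc)
    ultimately show ?thesis by (simp only:)
  qed
  have cH: "converges_on_disc H" by (rule converges_on_discI) (rule sums_summable, rule HI)
  have "g u = eval_real (gauss_fps 1 b c) u" if u: "norm u < 1" for u
  proof -
    have "gauss_fps 1 b c = one_minus_power (c - 1 - b) * H"
      using gauss_fps_euler_transformation[of c 1 b] assms by (simp add: H_def)
    then have "eval_real (gauss_fps 1 b c) u = eval_real (one_minus_power (c - 1 - b)) u * eval_real H u"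
      using u cH by (simp add: eval_real_mult one_minus_power_converges)
    also have "eval_real H u = of_real (c - 1) * I u" using sums_unique2[OF eval_real_sums[OF cH u] HI[OF u]] .
    finally show ?thesis using u by (simp add: eval_real_binom g_def)
  qed
  with gh show ?thesis by blast
qed

section \<open>The case of large c: the infimum is approached at -1\<close>

text \<open>
  To include \<open>c = 2\<close>, the continuation of \<open>F(1,b;c)\<close> is taken from that of \<open>F(1,b+1;c+1)\<close>.
\<close>
lemma gauss_fps_extensions:
  assumes "0 < b" "b \<le> c" "2 \<le> c"
  obtains F G where "F holomorphic_on cut_plane" "G holomorphic_on cut_plane"
    "\<And>z. norm z < 1 \<Longrightarrow> F z = eval_real (gauss_fps 1 b c) z" "\<And>z. norm z < 1 \<Longrightarrow> G z = eval_real (gauss_fps 2 b c) z"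
proof -
  obtain g where g: "g holomorphic_on cut_plane" "\<And>z. norm z < 1 \<Longrightarrow> g z = eval_real (gauss_fps 1 (b + 1) (c + 1)) z"
    using gauss_fps1_extension[of "c + 1" "b + 1"] assms by auto
  have cg: "converges_on_disc (gauss_fps 1 (b + 1) (c + 1))" and c1: "converges_on_disc (gauss_fps 1 b c)"
    and c2: "converges_on_disc (gauss_fps 2 b c)"
    using assms by (simp_all add: gauss_fps1_converges gauss_fps2_converges)
  define F where "F z = 1 + of_real (b / c) * z * g z" for z
  define G where "G z = (of_real (c - 1) + (of_real (2 - c) + of_real (b - 1) * z) * F z) / (1 - z)" for z
  have n1: "1 - z \<noteq> 0" if "z \<in> cut_plane" for z using cut_plane_not_nonpos[OF that, of 1] by auto
  have Fh: "F holomorphic_on cut_plane" unfolding F_def by (intro holomorphic_intros g)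
  have Gh: "G holomorphic_on cut_plane" unfolding G_def by (intro holomorphic_intros Fh n1)
  have F: "F z = eval_real (gauss_fps 1 b c) z" if z: "norm z < 1" for z
  proof -
    have "eval_real (gauss_fps 1 b c) z = eval_real (1 + fps_const (b / c) * fps_X * gauss_fps 1 (b + 1) (c + 1)) z"
      using gauss_fps1_lower[of c b] assms by simp
    then show ?thesis using z cg by (simp add: eval_real_simps F_def g)
  qed
  have G: "G z = eval_real (gauss_fps 2 b c) z" if z: "norm z < 1" for z
  proof -
    have "eval_real ((1 - fps_X) * gauss_fps 2 b c) z = eval_real (fps_const (c - 1) + (fps_const (2 - c) + fps_const (b - 1) * fps_X) * gauss_fps 1 b c) z"
      using gauss_fps2_linear[of c b] assms by simp
    then have "(1 - z) * eval_real (gauss_fps 2 b c) z = of_real (c - 1) + (of_real (2 - c) + of_real (b - 1) * z) * F z"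
      using z c1 c2 by (simp add: eval_real_simps F)
    moreover have "1 - z \<noteq> 0" using z by auto
    ultimately show ?thesis by (simp add: G_def field_simps)
  qed
  show thesis using that[OF Fh Gh F G] .
qed

text \<open>
  The real part of \<open>z F\<^sub>2' / F\<^sub>2\<close> in \<open>|z| \<le> r\<close> is bounded below by its value at \<open>-r\<close>, so its infimum over the
  disc is the limit of these values as \<open>r \<rightarrow> 1\<close>, to which the continuity of the extensions at \<open>-1\<close> applies.
\<close>
lemma convexity_large_c:
  assumes "0 < b" "b \<le> c" "2 \<le> c"
  shows "hyp2F1 2 b c (-1) \<noteq> 0"
    and "\<exists>k::real. order_of_convexity (\<lambda>z. z * hyp2F1 1 b c z) = Some (ereal k) \<and>
           complex_of_real k =
             complex_of_real ((4 - b - c) / 2)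
             + complex_of_real ((c - 2) / 2) * (hyp2F1 1 b c (-1) / hyp2F1 2 b c (-1))"
proof -
  obtain F G where FG: "F holomorphic_on cut_plane" "G holomorphic_on cut_plane"
    "\<And>z. norm z < 1 \<Longrightarrow> F z = eval_real (gauss_fps 1 b c) z" "\<And>z. norm z < 1 \<Longrightarrow> G z = eval_real (gauss_fps 2 b c) z"
    using gauss_fps_extensions[OF assms] by blast
  have "1 \<le> c" using assms by simp
  note c1 = gauss_fps1_converges[OF assms(1,2) this] and c2 = gauss_fps2_converges[OF assms(1,2) this]
    and nz = gauss_fps2_nonzero[OF assms(1,2) this] and ge = gauss_fps2_norm_ge[OF assms(1,2) this]
    and order = order_of_convexity_eq_INF[OF assms(1,2) this]
  have m1: "-1 \<in> cut_plane"
  proof -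
    have "- 1 \<noteq> complex_of_real x" if "1 \<le> x" for x using that by (auto simp: complex_eq_iff)
    then show ?thesis by (auto simp: cut_plane_def)
  qed
  have val: "hyp2F1 1 b c (-1) = F (-1)" "hyp2F1 2 b c (-1) = G (-1)"
    using hyp2F1_extension[OF FG(1) FG(3) m1] hyp2F1_extension[OF FG(2) FG(4) m1] by auto
  define p where "p z = z * eval_real (fps_deriv (gauss_fps 2 b c)) z / eval_real (gauss_fps 2 b c) z" for z
  \<comment> \<open>\<open>p = 2 (f - 1)\<close> for the Hausdorff moment series \<open>f = F(3,b;c) / F(2,b;c)\<close>.\<close>
  obtain f where f: "hausdorff_moment (fps_nth f)" "converges_on_disc (gauss_fps 3 b c)"
    "\<And>z. norm z < 1 \<Longrightarrow> eval_real (gauss_fps 3 b c) z = eval_real f z * eval_real (gauss_fps 2 b c) z"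
    using gauss_fps_step[of 2 c b] assms c2 by auto
  have pf: "p z = 2 * (eval_real f z - 1)" if z: "norm z < 1" for z
  proof -
    have "eval_real (fps_X * fps_deriv (gauss_fps 2 b c)) z = eval_real (fps_const 2 * (gauss_fps 3 b c - gauss_fps 2 b c)) z"
      using gauss_fps_euler_operator[of 2 b c] by simp
    then have "z * eval_real (fps_deriv (gauss_fps 2 b c)) z = 2 * (eval_real f z - 1) * eval_real (gauss_fps 2 b c) z"
      using z c2 f(2) by (simp add: eval_real_simps f(3) algebra_simps)
    then show ?thesis using nz[OF z] by (simp add: p_def)
  qed
  have mono: "Re (p (- of_real r)) \<le> Re (p z)" if "norm z \<le> r" "r < 1" for z r
  proof -
    have "norm (- complex_of_real r) < 1" using that norm_ge_zero[of z] by (simp del: norm_ge_zero)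
    then show ?thesis using that pf hausdorff_Re_ge_negative_axis[OF f(1) that] by (simp add: eval_real_def)
  qed
  have ev01: "eventually (\<lambda>r::real. 0 < r \<and> r < 1) (at_left 1)"
    using eventually_at_left_real[of 0 "1::real"] by simp
  have lim1: "((\<lambda>r. - complex_of_real r) \<longlongrightarrow> -1) (at_left 1)"
    by (auto intro!: tendsto_eq_intros)
  have lim: "((\<lambda>r. g (- complex_of_real r)) \<longlongrightarrow> g (-1)) (at_left 1)" if "g holomorphic_on cut_plane" for g
  proof -
    have "isCont g (-1)"
      using that holomorphic_on_imp_continuous_on open_cut_plane m1 continuous_on_eq_continuous_at by blast
    then show ?thesis using lim1 by (rule isCont_tendsto_compose)
  qed
  have G1: "norm (G (-1)) \<ge> 1 / 4"
  proof (rule tendsto_lowerbound[OF tendsto_norm[OF lim[OF FG(2)]]])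
    show "\<forall>\<^sub>F r in at_left 1. 1 / 4 \<le> norm (G (- complex_of_real r))"
      using ev01 by eventually_elim (use ge FG(4) in auto)
  qed simp
  then have G1': "G (-1) \<noteq> 0" by auto
  then show "hyp2F1 2 b c (-1) \<noteq> 0" by (simp add: val)
  define \<kappa> where "\<kappa> = (of_real (2 - c - b) + of_real (c - 2) * (F (-1) / G (-1))) / 2"
  have peq: "p (- of_real r) = (of_real (2 - c) + of_real b * (- of_real r)
      + of_real (c - 2) * (F (- of_real r) / G (- of_real r))) / (1 - (- of_real r))" if r: "0 < r" "r < 1" for r
  proof -
    define z where "z = - complex_of_real r"
    have z: "norm z < 1" "1 - z \<noteq> 0" using r by (auto simp: z_def complex_eq_iff)
    have "eval_real (fps_X * (1 - fps_X) * fps_deriv (gauss_fps 2 b c)) z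
       = eval_real ((fps_const (2 - c) + fps_const b * fps_X) * gauss_fps 2 b c + fps_const (c - 2) * gauss_fps 1 b c) z"
      using gauss_fps2_deriv_linear[of c b] assms by simp
    then have "z * (1 - z) * eval_real (fps_deriv (gauss_fps 2 b c)) z
       = (of_real (2 - c) + of_real b * z) * G z + of_real (c - 2) * F z"
      using z c1 c2 by (simp add: eval_real_simps FG)
    moreover have "G z \<noteq> 0" using nz z by (simp add: FG)
    ultimately have "p z = (of_real (2 - c) + of_real b * z + of_real (c - 2) * (F z / G z)) / (1 - z)"
      using z unfolding p_def FG(4)[OF z(1), symmetric] by (simp add: divide_simps) (simp add: mult_ac)
    then show ?thesis by (simp add: z_def)
  qed
  have plim: "((\<lambda>r. p (- complex_of_real r)) \<longlongrightarrow> \<kappa>) (at_left 1)"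
  proof (rule Lim_transform_eventually)
    show "\<forall>\<^sub>F r in at_left 1. (of_real (2 - c) + of_real b * (- of_real r)
      + of_real (c - 2) * (F (- of_real r) / G (- of_real r))) / (1 - (- of_real r)) = p (- complex_of_real r)"
      using ev01 by eventually_elim (rule peq[symmetric], auto)
    show "((\<lambda>r. (of_real (2 - c) + of_real b * (- of_real r)
      + of_real (c - 2) * (F (- of_real r) / G (- of_real r))) / (1 - (- of_real r))) \<longlongrightarrow> \<kappa>) (at_left 1)"
      unfolding \<kappa>_def using G1' by (auto intro!: tendsto_eq_intros lim FG)
  qed
  have real: "\<kappa> \<in> \<real>"
  proof (rule Lim_in_closed_set[OF closed_complex_Reals _ _ plim])
    show "\<forall>\<^sub>F r in at_left 1. p (- complex_of_real r) \<in> \<real>"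
      using ev01
    proof eventually_elim
      case (elim r)
      then show ?case
        using eval_real_of_real_in_Reals[OF c2, of "- r"] eval_real_of_real_in_Reals[OF converges_on_disc_deriv[OF c2], of "- r"]
        by (simp add: p_def)
    qed
  qed simp
  have relim: "((\<lambda>r. Re (p (- complex_of_real r))) \<longlongrightarrow> Re \<kappa>) (at_left 1)" using plim by (rule tendsto_Re)
  have "(INF z\<in>ball 0 1. ereal (Re (p z))) = ereal (Re \<kappa>)"
  proof (rule INF_ereal_eqI)
    fix z :: complex assume z: "z \<in> ball 0 1"
    show "Re \<kappa> \<le> Re (p z)"
    proof (rule tendsto_upperbound[OF relim])
      have "eventually (\<lambda>r. r \<in> {norm z<..<1}) (at_left 1)"
        using z by (intro eventually_at_left_real) simp
      then show "\<forall>\<^sub>F r in at_left 1. Re (p (- complex_of_real r)) \<le> Re (p z)"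
        by eventually_elim (use mono in auto)
    qed simp
  next
    fix e :: real assume "e > 0"
    then have "\<forall>\<^sub>F r in at_left 1. Re (p (- complex_of_real r)) < Re \<kappa> + e"
      by (intro order_tendstoD(2)[OF relim]) simp
    with ev01 have "\<forall>\<^sub>F r in at_left (1::real). \<exists>z\<in>ball 0 1. Re (p z) < Re \<kappa> + e"
      by eventually_elim (auto intro!: bexI[of _ "- of_real _"])
    then show "\<exists>z\<in>ball 0 1. Re (p z) < Re \<kappa> + e" by simp
  qed
  then have "order_of_convexity (\<lambda>z. z * hyp2F1 1 b c z) = Some (ereal (1 + Re \<kappa>))"
    using order by (simp add: p_def one_ereal_def)
  moreover have "complex_of_real (1 + Re \<kappa>) = complex_of_real ((4 - b - c) / 2)
             + complex_of_real ((c - 2) / 2) * (hyp2F1 1 b c (-1) / hyp2F1 2 b c (-1))"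
  proof -
    have "complex_of_real (Re \<kappa>) = \<kappa>" using real by (rule of_real_Re)
    then have "complex_of_real (1 + Re \<kappa>) = 1 + \<kappa>" by simp
    also have "\<dots> = complex_of_real ((4 - b - c) / 2) + complex_of_real ((c - 2) / 2) * (F (-1) / G (-1))"
      by (simp add: \<kappa>_def add_divide_distrib diff_divide_distrib algebra_simps)
    finally show ?thesis by (simp only: val)
  qed
  ultimately show "\<exists>k::real. order_of_convexity (\<lambda>z. z * hyp2F1 1 b c z) = Some (ereal k) \<and>
           complex_of_real k = complex_of_real ((4 - b - c) / 2)
             + complex_of_real ((c - 2) / 2) * (hyp2F1 1 b c (-1) / hyp2F1 2 b c (-1))" by blast
qed

section \<open>The case of small c: the infimum is approached at 1\<close>

text \<open>
  The evaluation is the sum of the series wherever that converges, so the same expression denotes the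
  continuous extension to the closed disc.
\<close>
lemma eval_real_continuous_on_cball:
  assumes "summable (\<lambda>n. \<bar>f $ n\<bar>)"
  shows "continuous_on (cball 0 1) (eval_real f)"
proof -
  have "uniform_limit (cball 0 1) (\<lambda>N z. \<Sum>n<N. complex_of_real (f $ n) * z ^ n)
      (\<lambda>z. \<Sum>n. of_real (f $ n) * z ^ n) sequentially"
    by (rule Weierstrass_m_test[OF _ assms])
       (auto simp: norm_mult norm_power power_le_one intro!: mult_left_le)
  then have "continuous_on (cball 0 1) (\<lambda>z. \<Sum>n. complex_of_real (f $ n) * z ^ n)"
    by (rule uniform_limit_theorem[rotated]) (auto intro!: always_eventually continuous_intros)
  then show ?thesis by (simp add: eval_real_def[abs_def] eval_fps_def[abs_def])
qed

lemma converges_on_disc_summable: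
  assumes "summable (\<lambda>n. \<bar>f $ n\<bar>)"
  shows "converges_on_disc f"
proof (rule converges_on_discI)
  fix z :: complex assume "norm z < 1"
  then show "summable (\<lambda>n. of_real (f $ n) * z ^ n)"
    by (intro summable_comparison_test'[OF assms, of 0])
       (auto simp: norm_mult norm_power power_le_one intro!: mult_left_le)
qed

lemma norm_series_le:
  fixes w :: "nat \<Rightarrow> real"
  assumes "(\<lambda>n. of_real (w n) * z ^ Suc n) sums s" "summable w" "\<And>n. 0 \<le> w n" "norm (z::complex) \<le> 1"
  shows "norm s \<le> suminf w"
proof -
  have le: "norm (of_real (w n) * z ^ Suc n) \<le> w n" for n
    using assms(3)[of n] power_le_one[OF norm_ge_zero assms(4), of "Suc n"]
    by (simp only: norm_mult norm_power norm_of_real abs_of_nonneg) (rule mult_left_le)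
  have sm: "summable (\<lambda>n. norm (of_real (w n) * z ^ Suc n))"
    by (rule summable_comparison_test'[OF assms(2), of 0]) (use le in auto)
  have "norm s \<le> (\<Sum>n. norm (of_real (w n) * z ^ Suc n))"
    using summable_norm[OF sm] assms(1) by (simp add: sums_iff)
  also have "\<dots> \<le> suminf w" by (rule suminf_le[OF le sm assms(2)])
  finally show ?thesis .
qed

lemma Re_of_real_mult: "Re (of_real x * z) = x * Re z"
  by simp

text \<open>
  The map \<open>z \<mapsto> z / (1 - z)\<close> sends the unit disc onto the half-plane right of \<open>-1/2\<close>.
\<close>
lemma disc_to_half_plane:
  assumes "norm (z :: complex) < 1"
  shows "Re (z / (1 - z)) \<ge> - 1 / 2"
proof -
  define w where "w = 1 - z"
  have w: "w \<noteq> 0" "z = 1 - w" using assms by (auto simp: w_def)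
  have "norm (1 - w) < 1" using assms w by simp
  then have "(norm (1 - w))\<^sup>2 < 1" by (simp add: abs_square_less_1)
  moreover have "(norm (1 - w))\<^sup>2 = (1 - Re w)\<^sup>2 + (Im w)\<^sup>2" by (simp add: cmod_power2)
  ultimately have "(Re w)\<^sup>2 + (Im w)\<^sup>2 < 2 * Re w" by (simp add: power2_diff)
  moreover have "(Re w)\<^sup>2 + (Im w)\<^sup>2 > 0" using w by (simp add: complex_eq_iff sum_power2_gt_zero_iff)
  ultimately have "Re (1 / w) \<ge> 1 / 2" by (simp add: Re_divide power2_eq_square field_simps)
  moreover have "z / (1 - z) = 1 / w - 1" using w(1) by (simp add: w(2) diff_divide_distrib)
  ultimately show ?thesis by simp
qed

text \<open>
  In this regime \<open>F(2,b;c) = (1 - z)\<^bsup>c-b-2\<^esup> H\<close> with \<open>H = 1 - \<Sum>n. q n z\<^bsup>n+1\<^esup>\<close> and \<open>q n \<ge> 0\<close>. The constants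
  \<open>\<delta> = 1 + b - c\<close> and \<open>- A = (c - 2) (c - b)\<close> are the coefficients left in the hypergeometric equation of \<open>H\<close>
  at \<open>z = 1\<close>, which reads \<open>\<delta> H'(1) = - A H(1)\<close>. Here \<open>S0 = 1 - H(1)\<close> and \<open>S1 = - H'(1)\<close>.
\<close>
locale small_c =
  fixes b c :: real
  assumes b: "0 < b" and bc: "b \<le> c" and c1: "1 \<le> c" and c2: "c < 2" and c3: "c < 1 + b"
begin

definition H :: "real fps" where "H = gauss_fps (c - 2) (c - b) c"
definition q :: "nat \<Rightarrow> real" where "q n = - (H $ Suc n)"
definition A :: real where "A = (2 - c) * (c - b)"
definition \<delta> :: real where "\<delta> = 1 + b - c"

lemma signs: "0 \<le> A" "0 < \<delta>" "0 < c"
  using b bc c1 c2 c3 by (auto simp: A_def \<delta>_def)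

lemma q_rec: "(c + real n + 1) * (real n + 2) * q (Suc n) = (c - 1 + real n) * (c - b + 1 + real n) * q n"
  using gauss_fps_rec[of c "Suc n" "c - 2" "c - b"] signs by (simp add: q_def H_def algebra_simps)

lemma q_0: "c * q 0 = A"
  using gauss_fps_rec[of c 0 "c - 2" "c - b"] signs by (simp add: q_def H_def A_def algebra_simps)

lemma q_nonneg: "0 \<le> q n"
proof (induction n)
  case 0
  show ?case using q_0 signs by (metis mult_le_cancel_left_pos mult_zero_right)
next
  case (Suc n)
  have "0 \<le> (c - 1 + real n) * (c - b + 1 + real n) * q n" using Suc bc c1 by simp
  then have "0 \<le> (c + real n + 1) * (real n + 2) * q (Suc n)" by (simp only: q_rec)
  moreover have "0 < (c + real n + 1) * (real n + 2)" using signs by (intro mult_pos_pos) auto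
  ultimately show ?case by (simp add: zero_le_mult_iff)
qed

text \<open>
  The coefficient recursion of \<open>H\<close> makes the weighted sum telescope. As all terms on the left-hand side are
  nonnegative, this bounds the partial sums and gives convergence on the closed disc.
\<close>
lemma q_telescope:
  "(\<Sum>n<N. (\<delta> * (real n + 1) + A) * q n) + (real N + 1) * (real N + c) * q N = A"
proof (induction N)
  case 0
  then show ?case using q_0 by simp
next
  case (Suc N)
  have "(real N + 2) * (real N + 1 + c) * q (Suc N) = (c - 1 + real N) * (c - b + 1 + real N) * q N"
    using q_rec[of N] by (simp add: mult_ac add_ac)
  also have "\<dots> = (real N + 1) * (real N + c) * q N - (\<delta> * (real N + 1) + A) * q N"
    by (simp add: A_def \<delta>_def algebra_simps)
  finally show ?case using Suc by (simp add: add_ac)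
qed

lemma nq_summable: "summable (\<lambda>n. (real n + 1) * q n)"
proof (rule summableI_nonneg_bounded[of _ "A / \<delta>"])
  fix N
  have "(\<Sum>n<N. \<delta> * ((real n + 1) * q n)) \<le> (\<Sum>n<N. (\<delta> * (real n + 1) + A) * q n)"
    using signs q_nonneg by (intro sum_mono) (simp add: algebra_simps)
  also have "\<dots> \<le> A"
  proof -
    have "0 \<le> (real N + 1) * (real N + c) * q N" using signs q_nonneg by (intro mult_nonneg_nonneg) auto
    then show ?thesis using q_telescope[of N] by linarith
  qed
  finally have "\<delta> * (\<Sum>n<N. (real n + 1) * q n) \<le> A" by (simp only: sum_distrib_left)
  then show "(\<Sum>n<N. (real n + 1) * q n) \<le> A / \<delta>" using signs by (simp add: field_simps)
qed (simp add: q_nonneg)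

lemma q_summable: "summable q"
proof (rule summable_comparison_test'[OF nq_summable])
  fix n show "norm (q n) \<le> (real n + 1) * q n"
    using q_nonneg[of n] by (simp add: algebra_simps)
qed

definition S0 where "S0 = suminf q"
definition S1 where "S1 = (\<Sum>n. (real n + 1) * q n)"

text \<open>
  The boundary term \<open>(N + 1) (N + c) q N\<close> converges by telescoping. A positive limit would make
  \<open>(n + 1) q n\<close> comparable to the harmonic series, contrary to its summability.
\<close>
lemma sum_relation: "\<delta> * S1 + A * S0 = A"
proof -
  define t where "t N = (real N + 1) * (real N + c) * q N" for N
  have t0: "0 \<le> t N" for N unfolding t_def using signs q_nonneg by (intro mult_nonneg_nonneg) auto
  have "(\<lambda>N. \<Sum>n<N. (\<delta> * (real n + 1) + A) * q n) \<longlonglongrightarrow> \<delta> * S1 + A * S0"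
  proof -
    have "(\<lambda>n. \<delta> * ((real n + 1) * q n) + A * q n) sums (\<delta> * S1 + A * S0)"
      unfolding S0_def S1_def by (intro sums_add sums_mult summable_sums nq_summable q_summable)
    then show ?thesis unfolding sums_def by (simp add: algebra_simps)
  qed
  then have "(\<lambda>N. A - (\<Sum>n<N. (\<delta> * (real n + 1) + A) * q n)) \<longlonglongrightarrow> A - (\<delta> * S1 + A * S0)"
    by (intro tendsto_diff tendsto_const)
  moreover have "A - (\<Sum>n<N. (\<delta> * (real n + 1) + A) * q n) = t N" for N
    using q_telescope[of N] by (simp add: t_def)
  moreover define T where "T = A - (\<delta> * S1 + A * S0)"
  ultimately have tl: "t \<longlonglongrightarrow> T" by (simp only:)
  have "T \<ge> 0" using tl t0 by (intro LIMSEQ_le_const) auto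
  moreover have "\<not> T > 0"
  proof
    assume T: "T > 0"
    then have "eventually (\<lambda>N. t N > T / 2) sequentially" by (intro order_tendstoD(1)[OF tl]) simp
    then obtain M where M: "\<And>N. N \<ge> M \<Longrightarrow> t N > T / 2" unfolding eventually_sequentially by blast
    have "summable (\<lambda>N. T / 2 / (real N + 2))"
    proof (rule summable_comparison_test'[OF nq_summable])
      fix N assume "N \<ge> M"
      then have "T / 2 < (real N + c) * ((real N + 1) * q N)" using M by (simp add: t_def mult_ac)
      also have "\<dots> \<le> (real N + 2) * ((real N + 1) * q N)"
        using c2 q_nonneg by (intro mult_right_mono) auto
      finally have "T / 2 < (real N + 2) * ((real N + 1) * q N)" .
      then have "T / 2 / (real N + 2) \<le> (real N + 1) * q N" by (simp add: field_simps)
      then show "norm (T / 2 / (real N + 2)) \<le> (real N + 1) * q N" using T by simp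
    qed
    then have "summable (\<lambda>N. (T / 2) * inverse (real (N + 2)))" by (simp add: field_simps)
    then have "summable (\<lambda>N. inverse (real (N + 2)))" using T by (subst (asm) summable_cmult_iff) simp
    then have "summable (\<lambda>N. inverse (real N))" using summable_iff_shift[of "\<lambda>n. inverse (real n)" 2] by blast
    then show False using not_summable_harmonic[where 'a = real] by (simp add: inverse_eq_divide)
  qed
  ultimately show ?thesis unfolding T_def by linarith
qed

lemma S0_le_S1: "0 \<le> S0" "S0 \<le> S1"
proof -
  show "0 \<le> S0" unfolding S0_def by (intro suminf_nonneg q_summable q_nonneg)
  have "q n \<le> (real n + 1) * q n" for n using q_nonneg[of n] by (simp add: algebra_simps)
  then show "S0 \<le> S1" unfolding S0_def S1_def by (intro suminf_le q_summable nq_summable)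
qed

lemma S0_less_1: "S0 < 1"
proof (rule ccontr)
  assume "\<not> S0 < 1"
  then have "A * 1 \<le> A * S0" using signs by (intro mult_left_mono) auto
  then have "\<delta> * S1 \<le> 0" using sum_relation by simp
  then have "S1 \<le> 0" using signs by (simp add: mult_le_0_iff)
  with S0_le_S1 \<open>\<not> S0 < 1\<close> show False by simp
qed

lemma S1_ratio: "S1 / (1 - S0) = A / \<delta>"
  using sum_relation signs S0_less_1 by (simp add: field_simps)

lemma H_summable: "summable (\<lambda>n. \<bar>H $ n\<bar>)" "summable (\<lambda>n. \<bar>(fps_X * fps_deriv H) $ n\<bar>)"
proof -
  have "summable (\<lambda>n. \<bar>H $ Suc n\<bar>)" using q_summable q_nonneg by (simp add: q_def[abs_def] abs_of_nonpos)
  then show "summable (\<lambda>n. \<bar>H $ n\<bar>)" by (rule summable_Suc_iff[of "\<lambda>n. \<bar>H $ n\<bar>", THEN iffD1])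
  have "\<bar>(fps_X * fps_deriv H) $ Suc n\<bar> = (real n + 1) * q n" for n
    using q_nonneg[of n] by (simp add: q_def abs_mult)
  then have "summable (\<lambda>n. \<bar>(fps_X * fps_deriv H) $ Suc n\<bar>)" using nq_summable by simp
  then show "summable (\<lambda>n. \<bar>(fps_X * fps_deriv H) $ n\<bar>)" by (rule summable_Suc_iff[of "\<lambda>n. \<bar>(fps_X * fps_deriv H) $ n\<bar>", THEN iffD1])
qed

lemma H_sums:
  assumes "norm z \<le> 1"
  shows "(\<lambda>n. of_real (q n) * z ^ Suc n) sums (1 - eval_real H z)"
    and "(\<lambda>n. of_real ((real n + 1) * q n) * z ^ Suc n) sums (- eval_real (fps_X * fps_deriv H) z)"
proof -
  have *: "(\<lambda>n. of_real (f $ n) * z ^ n) sums eval_real f z" if "summable (\<lambda>n. \<bar>f $ n\<bar>)" for f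
  proof -
    have "summable (\<lambda>n. complex_of_real (f $ n) * z ^ n)"
      by (rule summable_comparison_test'[OF that, of 0])
         (use assms in \<open>auto simp: norm_mult norm_power power_le_one intro!: mult_left_le\<close>)
    then show ?thesis by (simp add: eval_real_def eval_fps_def summable_sums)
  qed
  have "(\<lambda>n. of_real (H $ Suc n) * z ^ Suc n) sums (eval_real H z - 1)"
    using *[OF H_summable(1)] by (subst sums_Suc_iff) (simp add: H_def)
  from sums_minus[OF this] show "(\<lambda>n. of_real (q n) * z ^ Suc n) sums (1 - eval_real H z)"
    by (simp add: q_def)
  have "(\<lambda>n. of_real ((fps_X * fps_deriv H) $ Suc n) * z ^ Suc n) sums eval_real (fps_X * fps_deriv H) z"
    using *[OF H_summable(2)] by (subst sums_Suc_iff) simp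
  from sums_minus[OF this] show "(\<lambda>n. of_real ((real n + 1) * q n) * z ^ Suc n) sums (- eval_real (fps_X * fps_deriv H) z)"
    by (simp add: q_def algebra_simps)
qed

text \<open>
  Both bounds are the moduli at \<open>z = 1\<close>, by the triangle inequality and \<open>q n \<ge> 0\<close>.
\<close>
lemma H_norm_bounds:
  assumes z: "norm z \<le> 1"
  shows "1 - S0 \<le> norm (eval_real H z)" "norm (eval_real (fps_X * fps_deriv H) z) \<le> S1"
proof -
  have "norm (1 - eval_real H z) \<le> S0"
    unfolding S0_def by (rule norm_series_le[OF H_sums(1)[OF z] q_summable q_nonneg z])
  then show "1 - S0 \<le> norm (eval_real H z)"
    using norm_triangle_ineq2[of 1 "1 - eval_real H z"] by simp
  have "norm (- eval_real (fps_X * fps_deriv H) z) \<le> S1"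
    unfolding S1_def
    by (rule norm_series_le[OF H_sums(2)[OF z] nq_summable _ z]) (simp add: q_nonneg)
  then show "norm (eval_real (fps_X * fps_deriv H) z) \<le> S1" by simp
qed

lemma H_at_1: "eval_real H 1 = of_real (1 - S0)" "eval_real (fps_X * fps_deriv H) 1 = - of_real S1"
proof -
  have "(\<lambda>n. complex_of_real (q n)) sums of_real S0"
    unfolding S0_def by (intro sums_of_real summable_sums q_summable)
  moreover have "(\<lambda>n. complex_of_real (q n)) sums (1 - eval_real H 1)" using H_sums(1)[of 1] by simp
  ultimately have "1 - eval_real H 1 = of_real S0" using sums_unique2 by blast
  then show "eval_real H 1 = of_real (1 - S0)" by (simp add: algebra_simps)
  have "(\<lambda>n. complex_of_real ((real n + 1) * q n)) sums of_real S1"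
    unfolding S1_def by (intro sums_of_real summable_sums nq_summable)
  moreover have "(\<lambda>n. complex_of_real ((real n + 1) * q n)) sums (- eval_real (fps_X * fps_deriv H) 1)"
    using H_sums(2)[of 1] by simp
  ultimately have "- eval_real (fps_X * fps_deriv H) 1 = of_real S1" using sums_unique2 by blast
  then show "eval_real (fps_X * fps_deriv H) 1 = - of_real S1" by (metis minus_minus)
qed

lemma log_derivative:
  assumes z: "norm z < 1"
  shows "z * eval_real (fps_deriv (gauss_fps 2 b c)) z / eval_real (gauss_fps 2 b c) z
     = of_real (2 + b - c) * (z / (1 - z)) + eval_real (fps_X * fps_deriv H) z / eval_real H z"
proof -
  define s where "s = c - 2 - b"
  have cH: "converges_on_disc H" by (rule converges_on_disc_summable[OF H_summable(1)])
  have cB: "converges_on_disc (one_minus_power s)" "converges_on_disc (one_minus_power (-s))" by (rule one_minus_power_converges)+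
  have G: "gauss_fps 2 b c = one_minus_power s * H"
    using gauss_fps_euler_transformation[of c 2 b] signs by (simp add: s_def H_def)
  have "eval_real ((1 - fps_X) * fps_deriv (one_minus_power s)) z = eval_real (fps_const (- s) * one_minus_power s) z" by (simp only: one_minus_power_ode)
  then have B1: "(1 - z) * eval_real (fps_deriv (one_minus_power s)) z = - of_real s * eval_real (one_minus_power s) z"
    using z cB by (simp add: eval_real_simps del: fps_const_neg)
  have "eval_real (one_minus_power s * one_minus_power (- s)) z = 1" by (simp add: one_minus_power_inverse eval_real_basic)
  then have B0: "eval_real (one_minus_power s) z \<noteq> 0" using z cB by (auto simp: eval_real_simps)
  have H0: "eval_real H z \<noteq> 0" using H_norm_bounds(1)[of z] z S0_less_1 by auto
  have z1: "1 - z \<noteq> 0" using z by auto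
  have "fps_deriv (gauss_fps 2 b c) = fps_deriv (one_minus_power s) * H + one_minus_power s * fps_deriv H"
    by (simp add: G)
  then have "z * eval_real (fps_deriv (gauss_fps 2 b c)) z / eval_real (gauss_fps 2 b c) z
    = z * (eval_real (fps_deriv (one_minus_power s)) z * eval_real H z + eval_real (one_minus_power s) z * eval_real (fps_deriv H) z) / (eval_real (one_minus_power s) z * eval_real H z)"
    using z cB cH by (simp only: G eval_real_simps)
  also have "eval_real (fps_deriv (one_minus_power s)) z = - of_real s * eval_real (one_minus_power s) z / (1 - z)"
    using B1 z1 by (simp add: field_simps)
  also have "z * (- of_real s * eval_real (one_minus_power s) z / (1 - z) * eval_real H z + eval_real (one_minus_power s) z * eval_real (fps_deriv H) z) / (eval_real (one_minus_power s) z * eval_real H z)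
    = - of_real s * (z / (1 - z)) + z * eval_real (fps_deriv H) z / eval_real H z"
    using B0 H0 z1 by (simp add: divide_simps) (simp add: algebra_simps)
  finally show ?thesis using z cH by (simp add: eval_real_simps s_def)
qed

text \<open>
  The two summands of the logarithmic derivative are bounded below separately. Along a path to \<open>1\<close> inside
  the disc on which \<open>Re (z / (1 - z))\<close> tends to \<open>-1/2\<close>, the second summand tends to its minimum by continuity,
  so the sum of the two bounds is the infimum.
\<close>
lemma order_value:
  "order_of_convexity (\<lambda>z. z * hyp2F1 1 b c z) = Some (ereal ((c - b) * (c + b - 3) / (2 * (1 + b - c))))"
proof -
  define u where "u z = Re (z * eval_real (fps_deriv (gauss_fps 2 b c)) z / eval_real (gauss_fps 2 b c) z)" for z
  define k where "k = - (2 + b - c) / 2 - A / \<delta>"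
  define R where "R z = eval_real (fps_X * fps_deriv H) z / eval_real H z" for z
  have u: "u z = (2 + b - c) * Re (z / (1 - z)) + Re (R z)" if "norm z < 1" for z
    unfolding u_def log_derivative[OF that] R_def plus_complex.sel Re_of_real_mult by (rule refl)
  have pos: "0 < 2 + b - c" using c3 by simp
  have "(INF z\<in>ball 0 1. ereal (u z)) = ereal k"
  proof (rule INF_ereal_eqI)
    fix z :: complex assume "z \<in> ball 0 1"
    then have z: "norm z < 1" by simp
    have "norm (R z) \<le> S1 / (1 - S0)"
      unfolding R_def norm_divide using H_norm_bounds[of z] z S0_less_1 S0_le_S1 by (intro frac_le) auto
    then have "- (A / \<delta>) \<le> Re (R z)" using abs_Re_le_cmod[of "R z"] S1_ratio by simp
    moreover have "(2 + b - c) * (- 1 / 2) \<le> (2 + b - c) * Re (z / (1 - z))"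
      using disc_to_half_plane[OF z] pos by (intro mult_left_mono) auto
    ultimately show "k \<le> u z" by (simp add: u[OF z] k_def field_simps)
  next
    fix e :: real assume e: "e > 0"
    \<comment> \<open>The path is chosen through \<open>1 / (1 - z) = y\<close>: the real part \<open>1/2 + \<eta>\<close> keeps \<open>z\<close> in the disc
        and \<open>Re (z / (1 - z))\<close> near \<open>-1/2\<close>, and the imaginary part \<open>1/\<eta>\<close> makes \<open>z\<close> tend to \<open>1\<close>.\<close>
    define y where "y \<eta> = Complex (1 / 2 + \<eta>) (1 / \<eta>)" for \<eta> :: real
    define z where "z \<eta> = 1 - 1 / y \<eta>" for \<eta>
    have pos0: "eventually (\<lambda>\<eta>::real. \<eta> > 0) (at_right 0)" by (simp add: eventually_at_right_less)
    have y0: "y \<eta> \<noteq> 0" if "\<eta> > 0" for \<eta> using that by (simp add: y_def complex_eq_iff)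
    have zb: "norm (z \<eta>) < 1" and zr: "Re (z \<eta> / (1 - z \<eta>)) = - 1 / 2 + \<eta>" if "\<eta> > 0" for \<eta>
    proof -
      have "(norm (y \<eta> - 1))\<^sup>2 < (norm (y \<eta>))\<^sup>2"
        unfolding cmod_power2 using that by (simp add: y_def power2_eq_square algebra_simps)
      then have "norm (y \<eta> - 1) < norm (y \<eta>)" by (simp add: power2_less_imp_less)
      moreover have "z \<eta> = (y \<eta> - 1) / y \<eta>" using y0[OF that] by (simp add: z_def field_simps)
      ultimately show "norm (z \<eta>) < 1" using y0[OF that] by (simp add: norm_divide)
      have "z \<eta> / (1 - z \<eta>) = y \<eta> - 1" using y0[OF that] by (simp add: z_def field_simps)
      then show "Re (z \<eta> / (1 - z \<eta>)) = - 1 / 2 + \<eta>" by (simp add: y_def)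
    qed
    have "((\<lambda>\<eta>. 1 / y \<eta>) \<longlongrightarrow> 0) (at_right 0)"
    proof (rule Lim_null_comparison)
      show "\<forall>\<^sub>F \<eta> in at_right 0. norm (1 / y \<eta>) \<le> \<eta>"
        using pos0
      proof eventually_elim
        case (elim \<eta>)
        have "1 / \<eta> \<le> norm (y \<eta>)" using abs_Im_le_cmod[of "y \<eta>"] elim by (simp add: y_def)
        then show ?case using elim y0 by (simp add: norm_divide field_simps)
      qed
      show "((\<lambda>\<eta>::real. \<eta>) \<longlongrightarrow> 0) (at_right 0)" by (rule tendsto_ident_at)
    qed
    then have "(z \<longlongrightarrow> 1 - 0) (at_right 0)" unfolding z_def by (intro tendsto_diff tendsto_const)
    then have zl: "(z \<longlongrightarrow> 1) (at_right 0)" by simp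
    have evb: "\<forall>\<^sub>F \<eta> in at_right 0. z \<eta> \<in> cball 0 1"
      using pos0 by eventually_elim (use zb in \<open>auto intro: less_imp_le\<close>)
    have lim: "((\<lambda>\<eta>. eval_real f (z \<eta>)) \<longlongrightarrow> eval_real f 1) (at_right 0)" if "summable (\<lambda>n. \<bar>f $ n\<bar>)" for f
      by (rule continuous_on_tendsto_compose[OF eval_real_continuous_on_cball[OF that] zl _ evb]) simp
    have "1 - S0 \<noteq> 0" using S0_less_1 by simp
    then have "eval_real H 1 \<noteq> 0" unfolding H_at_1 by (simp only: of_real_eq_0_iff not_False_eq_True)
    then have "((\<lambda>\<eta>. R (z \<eta>)) \<longlongrightarrow> R 1) (at_right 0)"
      unfolding R_def by (intro tendsto_divide lim H_summable)
    moreover have "R 1 = of_real (- (S1 / (1 - S0)))"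
      unfolding R_def H_at_1 by (simp only: of_real_divide of_real_minus minus_divide_left)
    then have "R 1 = of_real (- A / \<delta>)" by (simp only: S1_ratio minus_divide_left)
    ultimately have "((\<lambda>\<eta>. R (z \<eta>)) \<longlongrightarrow> of_real (- A / \<delta>)) (at_right 0)" by simp
    from tendsto_Re[OF this] have Rl: "((\<lambda>\<eta>. Re (R (z \<eta>))) \<longlongrightarrow> - A / \<delta>) (at_right 0)" by simp
    have "((\<lambda>\<eta>. (2 + b - c) * (- 1 / 2 + \<eta>) + Re (R (z \<eta>))) \<longlongrightarrow> (2 + b - c) * (- 1 / 2 + 0) + - A / \<delta>) (at_right 0)"
      by (intro tendsto_intros Rl)
    then have "((\<lambda>\<eta>. (2 + b - c) * (- 1 / 2 + \<eta>) + Re (R (z \<eta>))) \<longlongrightarrow> k) (at_right 0)"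
      by (simp add: k_def field_simps)
    then have "\<forall>\<^sub>F \<eta> in at_right 0. (2 + b - c) * (- 1 / 2 + \<eta>) + Re (R (z \<eta>)) < k + e"
      using e by (intro order_tendstoD(2)) auto
    with pos0 have "\<forall>\<^sub>F \<eta> in at_right (0::real). \<exists>z\<in>ball 0 1. u z < k + e"
    proof eventually_elim
      case (elim \<eta>)
      then have "u (z \<eta>) < k + e" using u[OF zb] zr by simp
      then show ?case using zb[of \<eta>] elim by (intro bexI[of _ "z \<eta>"]) auto
    qed
    then show "\<exists>z\<in>ball 0 1. u z < k + e" by simp
  qed
  then have "order_of_convexity (\<lambda>z. z * hyp2F1 1 b c z) = Some (ereal (1 + k))"
    using order_of_convexity_eq_INF[OF b bc c1] by (simp add: u_def one_ereal_def)
  moreover have "1 + k = (c - b) * (c + b - 3) / (2 * (1 + b - c))"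
    using signs(2) by (simp add: k_def A_def \<delta>_def field_simps)
  ultimately show ?thesis by simp
qed

end

section \<open>The order of convexity\<close>

theorem theorem1p3:
  fixes b c :: real
  assumes "0 < b" and "b \<le> c"
  shows "(c \<ge> 2 \<longrightarrow>
            hyp2F1 2 b c (-1) \<noteq> 0 \<and>
            (\<exists>k::real. order_of_convexity (\<lambda>z. z * hyp2F1 1 b c z) = Some (ereal k) \<and>
               complex_of_real k =
                 complex_of_real ((4 - b - c) / 2)
                 + complex_of_real ((c - 2) / 2) * (hyp2F1 1 b c (-1) / hyp2F1 2 b c (-1))))
       \<and> (1 \<le> c \<and> c < min 2 (1 + b) \<longrightarrow>
            order_of_convexity (\<lambda>z. z * hyp2F1 1 b c z)
              = Some (ereal ((c - b) * (c + b - 3) / (2 * (1 + b - c)))))"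
proof (intro conjI impI)
  assume "2 \<le> c"
  then show "hyp2F1 2 b c (-1) \<noteq> 0"
    and "\<exists>k::real. order_of_convexity (\<lambda>z. z * hyp2F1 1 b c z) = Some (ereal k) \<and>
           complex_of_real k =
             complex_of_real ((4 - b - c) / 2)
             + complex_of_real ((c - 2) / 2) * (hyp2F1 1 b c (-1) / hyp2F1 2 b c (-1))"
    using convexity_large_c[OF assms] by blast+
next
  assume "1 \<le> c \<and> c < min 2 (1 + b)"
  then interpret small_c b c using assms by unfold_locales auto
  show "order_of_convexity (\<lambda>z. z * hyp2F1 1 b c z)
          = Some (ereal ((c - b) * (c + b - 3) / (2 * (1 + b - c))))"
    by (rule order_value)
qed

end
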